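(* Let $\mu>1$, $1/\mu<\lambda\le 1$ and $\kappa\ge \exp(\mathrm{e}^2)$ be real numbers. There is a constant $C_{\mu,\lambda,\kappa}>0$, depending only on $\mu,\lambda,\kappa$, such that the following holds. Let $\boldsymbol{\gamma}=(\gamma_j)_{j\in\mathbb{N}}$ be a sequence of positive real numbers with $\kappa\ge\sup_{j\in\mathbb{N}}\max\{\exp(\mathrm{e}^2),\exp(\mathrm{e}^2\gamma_j^{1/\mu})\}$, let $s\in\mathbb{N}$, let $N$ be a prime, and let $\boldsymbol{g}^\ast=(g_1^\ast,\ldots,g_s^\ast)\in\{1,\ldots,N-1\}^s$ be a vector constructed by the component-by-component algorithm (for the $\log$-Korobov space with parameters $\mu,\boldsymbol{\gamma},\kappa$). For $d\in\{1,\ldots,s\}$ put $$T_d(\mu,\lambda,\kappa,\boldsymbol{\gamma})=3\prod_{j=1}^d\left(1+2C_{\mu,\lambda,\kappa}\,\gamma_j\max\{1,\log\gamma_j^{-1}\}^{\mu(1-\lambda)}\right).$$ Then for every $d\in\{1,\ldots,s\}$, $$e^2(g_1^\ast,\ldots,g_d^\ast)\le\frac{T_d(\mu,\lambda,\kappa,\boldsymbol{\gamma})}{N\left(\log\left(N/T_d(\mu,\lambda,\kappa,\boldsymbol{\gamma})\right)\right)^{\mu(1-\lambda)}}$$ for any $N\ge\mathrm{e}^{2\mu}(2\mu)^{\mu(\lambda-1)}T_d(\mu,\lambda,\kappa,\boldsymbol{\gamma})$.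
   Context: $\log$ denotes the natural logarithm. $\log$-Korobov space. For $\mu>1$, positive weights $\boldsymbol{\gamma}=(\gamma_j)_{j\in\mathbb{N}}$ and a real $\kappa$ with $\kappa\ge\max\{\exp(\mathrm{e}^2),\exp(\mathrm{e}^2\gamma_j^{1/\mu})\}$ for all $j$, define for $k\in\mathbb{Z}$: $r_{\mu,\gamma}(0)=1$ and $r_{\mu,\gamma}(k)=\gamma|k|^{-1}(\log(\kappa|k|))^{-\mu}$ if $k\ne0$; for $\boldsymbol{k}\in\mathbb{Z}^s$ put $r_{\mu,\boldsymbol{\gamma}}(\boldsymbol{k})=\prod_{j=1}^s r_{\mu,\gamma_j}(k_j)$. The $\log$-Korobov space $H_{K_{\log,\mu,\boldsymbol{\gamma}}}$ (in dimension $s$) is the reproducing kernel Hilbert space of functions on $[0,1]^s$ with kernel $K_{\log,\mu,\boldsymbol{\gamma}}(\boldsymbol{x},\boldsymbol{y})=\sum_{\boldsymbol{k}\in\mathbb{Z}^s}r_{\mu,\boldsymbol{\gamma}}(\boldsymbol{k})\mathrm{e}^{2\pi\mathrm{i}\boldsymbol{k}\cdot(\boldsymbol{x}-\boldsymbol{y})}$ and inner product $\langle f,g\rangle=\sum_{\boldsymbol{k}\in\mathbb{Z}^s}\widehat f(\boldsymbol{k})\overline{\widehat g(\boldsymbol{k})}\,r_{\mu,\boldsymbol{\gamma}}^{-1}(\boldsymbol{k})$, where $\widehat f(\boldsymbol{k})=\int_{[0,1]^s}f(\boldsymbol{x})\mathrm{e}^{-2\pi\mathrm{i}\boldsymbol{k}\cdot\boldsymbol{x}}\,\mathrm{d}\boldsymbol{x}$.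 Worst-case error of a lattice rule. For a Hilbert space $H$ of functions on $[0,1]^s$ and points $P=\{\boldsymbol{x}_0,\ldots,\boldsymbol{x}_{N-1}\}$, $e(H,P)=\sup_{\|f\|_H\le1}\left|\int_{[0,1]^s}f(\boldsymbol{x})\,\mathrm{d}\boldsymbol{x}-\frac1N\sum_{n=0}^{N-1}f(\boldsymbol{x}_n)\right|$. For $N$ prime and $\boldsymbol{g}=(g_1,\ldots,g_d)\in\{1,\ldots,N-1\}^d$, the lattice point set with generating vector $\boldsymbol{g}$ consists of $\boldsymbol{x}_n=(\{ng_1/N\},\ldots,\{ng_d/N\})$, $0\le n\le N-1$, with $\{\cdot\}$ the fractional part. Write $e(\boldsymbol{g})$ for the worst-case error in the $d$-dimensional space $H_{K_{\log,\mu,\boldsymbol{\gamma}}}$ of this lattice rule; one has $e^2(\boldsymbol{g})=\sum_{\boldsymbol{k}\in L^\perp\setminus\{\boldsymbol{0}\}}r_{\mu,\boldsymbol{\gamma}}(\boldsymbol{k})$ with $L^\perp=\{\boldsymbol{\ell}\in\mathbb{Z}^d:\boldsymbol{\ell}\cdot\boldsymbol{g}\equiv0\pmod N\}$. Component-by-component algorithm. Given $s\in\mathbb{N}$ and a prime $N$: set $g_1^\ast=1$; for $d=1,\ldots,s-1$, with $g_1^\ast,\ldots,g_d^\ast$ already found, choose $g_{d+1}^\ast\in\{1,\ldots,N-1\}$ minimizing $g\mapsto e^2(g_1^\ast,\ldots,g_d^\ast,g)$ over $g\in\{1,\ldots,N-1\}$.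
   Formalization: The additional condition N > T_d is assumed: for large μ and small λ the stated lower bound on N does not imply it, and then log(N/T_d) is non-positive, so the bound is undefined or (e.g. μ=50, λ=0.06, N=2) false. *)

theory Defs
  imports "HOL-Analysis.Analysis" "HOL-Computational_Algebra.Primes"
begin

section \<open>Reproducing kernel Hilbert spaces\<close>

text \<open>
  A function on a set \<open>X\<close> is an element of \<open>extensional X\<close>. A space of functions is given by
  its carrier \<open>H\<close> and its inner product \<open>ip\<close>, linear in the first argument.
\<close>

definition ip_norm :: "('f \<Rightarrow> 'f \<Rightarrow> complex) \<Rightarrow> 'f \<Rightarrow> real" where
  "ip_norm ip f = sqrt (Re (ip f f))"

definition fun_space :: "'a set \<Rightarrow> ('a \<Rightarrow> complex) set \<Rightarrow> bool" where
  "fun_space X H \<longleftrightarrow>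
     H \<subseteq> extensional X \<and> (\<lambda>x\<in>X. 0) \<in> H \<and>
     (\<forall>f\<in>H. \<forall>g\<in>H. (\<lambda>x\<in>X. f x + g x) \<in> H) \<and>
     (\<forall>c. \<forall>f\<in>H. (\<lambda>x\<in>X. c * f x) \<in> H)"

definition inner_product_on ::
  "'a set \<Rightarrow> ('a \<Rightarrow> complex) set \<Rightarrow> (('a \<Rightarrow> complex) \<Rightarrow> ('a \<Rightarrow> complex) \<Rightarrow> complex) \<Rightarrow> bool" where
  "inner_product_on X H ip \<longleftrightarrow>
     (\<forall>f\<in>H. \<forall>g\<in>H. \<forall>h\<in>H. ip (\<lambda>x\<in>X. f x + g x) h = ip f h + ip g h) \<and>
     (\<forall>c. \<forall>f\<in>H. \<forall>g\<in>H. ip (\<lambda>x\<in>X. c * f x) g = c * ip f g) \<and>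
     (\<forall>f\<in>H. \<forall>g\<in>H. ip g f = cnj (ip f g)) \<and>
     (\<forall>f\<in>H. 0 \<le> Re (ip f f)) \<and>
     (\<forall>f\<in>H. ip f f = 0 \<longrightarrow> f = (\<lambda>x\<in>X. 0))"

definition ip_complete ::
  "'a set \<Rightarrow> ('a \<Rightarrow> complex) set \<Rightarrow> (('a \<Rightarrow> complex) \<Rightarrow> ('a \<Rightarrow> complex) \<Rightarrow> complex) \<Rightarrow> bool" where
  "ip_complete X H ip \<longleftrightarrow>
     (\<forall>F :: nat \<Rightarrow> 'a \<Rightarrow> complex.
        (\<forall>n. F n \<in> H) \<and>
        (\<forall>e>0. \<exists>n0. \<forall>m\<ge>n0. \<forall>n\<ge>n0. ip_norm ip (\<lambda>x\<in>X. F m x - F n x) < e) \<longrightarrow>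
        (\<exists>f\<in>H. (\<lambda>n. ip_norm ip (\<lambda>x\<in>X. F n x - f x)) \<longlonglongrightarrow> 0))"

definition is_rkhs ::
  "'a set \<Rightarrow> ('a \<Rightarrow> complex) set \<Rightarrow> (('a \<Rightarrow> complex) \<Rightarrow> ('a \<Rightarrow> complex) \<Rightarrow> complex) \<Rightarrow>
   ('a \<Rightarrow> 'a \<Rightarrow> complex) \<Rightarrow> bool" where
  "is_rkhs X H ip K \<longleftrightarrow>
     fun_space X H \<and> inner_product_on X H ip \<and> ip_complete X H ip \<and>
     (\<forall>y\<in>X. (\<lambda>x\<in>X. K x y) \<in> H \<and> (\<forall>f\<in>H. ip f (\<lambda>x\<in>X. K x y) = f y))"


section \<open>The log-Korobov space\<close>

text \<open>
  Points of \<open>[0,1]\<^sup>d\<close>, multi-indices in \<open>\<int>\<^sup>d\<close>, generating vectors and weights are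
  functions on \<^typ>\<open>nat\<close>, with coordinates numbered \<open>1, \<dots>, d\<close>.
\<close>

definition unit_cube :: "nat \<Rightarrow> (nat \<Rightarrow> real) set" where
  "unit_cube d = (\<Pi>\<^sub>E j\<in>{1..d}. {0..1})"

definition cube_measure :: "nat \<Rightarrow> (nat \<Rightarrow> real) measure" where
  "cube_measure d = (\<Pi>\<^sub>M j\<in>{1..d}. restrict_space lborel {0..1})"

definition multi_indices :: "nat \<Rightarrow> (nat \<Rightarrow> int) set" where
  "multi_indices d = (\<Pi>\<^sub>E j\<in>{1..d}. UNIV)"

definition index_dot :: "nat \<Rightarrow> (nat \<Rightarrow> int) \<Rightarrow> (nat \<Rightarrow> real) \<Rightarrow> real" where
  "index_dot d k x = (\<Sum>j=1..d. of_int (k j) * x j)"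

definition r1_weight :: "real \<Rightarrow> real \<Rightarrow> real \<Rightarrow> int \<Rightarrow> real" where
  "r1_weight \<mu> \<kappa> \<gamma> k =
     (if k = 0 then 1 else \<gamma> * inverse \<bar>of_int k\<bar> * ln (\<kappa> * \<bar>of_int k\<bar>) powr (- \<mu>))"

definition r_weight :: "real \<Rightarrow> real \<Rightarrow> (nat \<Rightarrow> real) \<Rightarrow> nat \<Rightarrow> (nat \<Rightarrow> int) \<Rightarrow> real" where
  "r_weight \<mu> \<kappa> \<gamma> d k = (\<Prod>j=1..d. r1_weight \<mu> \<kappa> (\<gamma> j) (k j))"

definition fourier_coeff :: "nat \<Rightarrow> ((nat \<Rightarrow> real) \<Rightarrow> complex) \<Rightarrow> (nat \<Rightarrow> int) \<Rightarrow> complex" where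
  "fourier_coeff d f k = (\<integral>x. f x * cis (- 2 * pi * index_dot d k x) \<partial>cube_measure d)"

definition korobov_kernel ::
  "real \<Rightarrow> real \<Rightarrow> (nat \<Rightarrow> real) \<Rightarrow> nat \<Rightarrow> (nat \<Rightarrow> real) \<Rightarrow> (nat \<Rightarrow> real) \<Rightarrow> complex" where
  "korobov_kernel \<mu> \<kappa> \<gamma> d x y =
     (\<Sum>\<^sub>\<infinity>k\<in>multi_indices d. of_real (r_weight \<mu> \<kappa> \<gamma> d k) * cis (2 * pi * index_dot d k (\<lambda>j. x j - y j)))"

definition korobov_ip ::
  "real \<Rightarrow> real \<Rightarrow> (nat \<Rightarrow> real) \<Rightarrow> nat \<Rightarrow>
   ((nat \<Rightarrow> real) \<Rightarrow> complex) \<Rightarrow> ((nat \<Rightarrow> real) \<Rightarrow> complex) \<Rightarrow> complex" where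
  "korobov_ip \<mu> \<kappa> \<gamma> d f g =
     (\<Sum>\<^sub>\<infinity>k\<in>multi_indices d.
        fourier_coeff d f k * cnj (fourier_coeff d g k) * of_real (inverse (r_weight \<mu> \<kappa> \<gamma> d k)))"

text \<open>
  The space is determined by its kernel and its inner product; existence and uniqueness are
  proved in \<open>korobov_rkhs_unique\<close> below.
\<close>

definition korobov_space ::
  "real \<Rightarrow> real \<Rightarrow> (nat \<Rightarrow> real) \<Rightarrow> nat \<Rightarrow> ((nat \<Rightarrow> real) \<Rightarrow> complex) set" where
  "korobov_space \<mu> \<kappa> \<gamma> d =
     (THE H. is_rkhs (unit_cube d) H (korobov_ip \<mu> \<kappa> \<gamma> d) (korobov_kernel \<mu> \<kappa> \<gamma> d))"


section \<open>Lattice rules and the component-by-component construction\<close>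

definition worst_case_error ::
  "nat \<Rightarrow> ((nat \<Rightarrow> real) \<Rightarrow> complex) set \<Rightarrow> (((nat \<Rightarrow> real) \<Rightarrow> complex) \<Rightarrow> real) \<Rightarrow>
   nat \<Rightarrow> (nat \<Rightarrow> nat \<Rightarrow> real) \<Rightarrow> real" where
  "worst_case_error d H nrm N x =
     (SUP f\<in>{f \<in> H. nrm f \<le> 1}.
        cmod ((\<integral>t. f t \<partial>cube_measure d) - (\<Sum>n<N. f (x n)) / of_nat N))"

definition lattice_point :: "nat \<Rightarrow> nat \<Rightarrow> (nat \<Rightarrow> nat) \<Rightarrow> nat \<Rightarrow> nat \<Rightarrow> real" where
  "lattice_point d N g n = (\<lambda>j\<in>{1..d}. frac (real n * real (g j) / real N))"

text \<open>Only \<open>g 1, \<dots>, g d\<close> enter the following definition.\<close>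

definition lattice_error ::
  "real \<Rightarrow> real \<Rightarrow> (nat \<Rightarrow> real) \<Rightarrow> nat \<Rightarrow> nat \<Rightarrow> (nat \<Rightarrow> nat) \<Rightarrow> real" where
  "lattice_error \<mu> \<kappa> \<gamma> N d g =
     worst_case_error d (korobov_space \<mu> \<kappa> \<gamma> d) (ip_norm (korobov_ip \<mu> \<kappa> \<gamma> d))
       N (lattice_point d N g)"

definition cbc_vector ::
  "real \<Rightarrow> real \<Rightarrow> (nat \<Rightarrow> real) \<Rightarrow> nat \<Rightarrow> nat \<Rightarrow> (nat \<Rightarrow> nat) \<Rightarrow> bool" where
  "cbc_vector \<mu> \<kappa> \<gamma> N s g \<longleftrightarrow>
     g 1 = 1 \<and>
     (\<forall>d\<in>{1..<s}.
        g (Suc d) \<in> {1..N - 1} \<and>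
        (\<forall>h\<in>{1..N - 1}.
           (lattice_error \<mu> \<kappa> \<gamma> N (Suc d) g)\<^sup>2
             \<le> (lattice_error \<mu> \<kappa> \<gamma> N (Suc d) (g(Suc d := h)))\<^sup>2))"

text \<open>
  The error bound \<open>T / (N * ln (N / T) powr (\<mu> * (1 - lam)))\<close> makes sense only for \<open>N > T\<close>:
  the base of the power has to be positive. This does not follow from the lower bound
  \<open>N \<ge> exp (2 * \<mu>) * (2 * \<mu>) powr (\<mu> * (lam - 1)) * T\<close>, because for large \<open>\<mu>\<close> the factor in
  front of \<open>T\<close> may be less than \<open>1\<close>. For \<open>N = T\<close> and \<open>lam < 1\<close> the totalised quotient would
  be \<open>0\<close>. Hence \<open>N > T\<close> is a separate assumption.
\<close>

definition T_bound :: "real \<Rightarrow> real \<Rightarrow> real \<Rightarrow> (nat \<Rightarrow> real) \<Rightarrow> nat \<Rightarrow> real" where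
  "T_bound C \<mu> lam \<gamma> d =
     3 * (\<Prod>j=1..d. 1 + 2 * C * \<gamma> j * max 1 (ln (inverse (\<gamma> j))) powr (\<mu> * (1 - lam)))"


section \<open>The log-Korobov space is well defined\<close>

subsection \<open>Spaces spanned by a system of unimodular functions\<close>

locale fourier_rkhs =
  fixes X :: "'a set" and I :: "'k set" and rr :: "'k \<Rightarrow> real"
    and E :: "'k \<Rightarrow> 'a \<Rightarrow> complex" and fc :: "('a \<Rightarrow> complex) \<Rightarrow> 'k \<Rightarrow> complex"
  assumes rr_pos: "k \<in> I \<Longrightarrow> 0 < rr k"
    and rr_sum: "rr summable_on I"
    and E_norm: "cmod (E k x) = 1"
    and fc_syn: "(\<lambda>k. cmod (c k)) summable_on I \<Longrightarrow> k \<in> I \<Longrightarrow>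
                   fc (\<lambda>x\<in>X. \<Sum>\<^sub>\<infinity>k\<in>I. c k * E k x) k = c k"
begin

definition syn :: "('k \<Rightarrow> complex) \<Rightarrow> 'a \<Rightarrow> complex" where
  "syn c = (\<lambda>x\<in>X. \<Sum>\<^sub>\<infinity>k\<in>I. c k * E k x)"

definition W :: "('k \<Rightarrow> complex) set" where
  "W = {c. (\<lambda>k. (cmod (c k))\<^sup>2 * inverse (rr k)) summable_on I}"

definition S :: "('k \<Rightarrow> complex) \<Rightarrow> ('k \<Rightarrow> complex) \<Rightarrow> complex" where
  "S a b = (\<Sum>\<^sub>\<infinity>k\<in>I. a k * cnj (b k) * of_real (inverse (rr k)))"

definition Q :: "('k \<Rightarrow> complex) \<Rightarrow> real" where
  "Q a = (\<Sum>\<^sub>\<infinity>k\<in>I. (cmod (a k))\<^sup>2 * inverse (rr k))"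

definition ip :: "('a \<Rightarrow> complex) \<Rightarrow> ('a \<Rightarrow> complex) \<Rightarrow> complex" where
  "ip f g = S (fc f) (fc g)"

definition K :: "'a \<Rightarrow> 'a \<Rightarrow> complex" where
  "K x y = (\<Sum>\<^sub>\<infinity>k\<in>I. of_real (rr k) * (E k x * cnj (E k y)))"

lemma rr_nz: "k \<in> I \<Longrightarrow> rr k \<noteq> 0"
  using rr_pos[of k] by simp

lemma W_abs:
  assumes "c \<in> W" shows "(\<lambda>k. cmod (c k)) summable_on I"
proof (rule summable_on_comparison_test)
  show "(\<lambda>k. (cmod (c k))\<^sup>2 * inverse (rr k) + rr k) summable_on I"
    using assms rr_sum by (intro summable_on_add) (auto simp: W_def)
  fix k assume k: "k \<in> I"
  have "0 \<le> (cmod (c k) - rr k)\<^sup>2 + cmod (c k) * rr k"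
    using rr_pos[OF k] by simp
  then have "cmod (c k) * rr k \<le> (cmod (c k))\<^sup>2 + rr k * rr k"
    by (simp add: power2_eq_square algebra_simps)
  then show "cmod (c k) \<le> (cmod (c k))\<^sup>2 * inverse (rr k) + rr k"
    using rr_pos[OF k] by (simp add: field_simps)
qed auto

lemma term_nonneg: "k \<in> I \<Longrightarrow> 0 \<le> (cmod (c k))\<^sup>2 * inverse (rr k)"
  using rr_pos[of k] by simp

lemma cmod_add_sq:
  assumes "t > 0"
  shows "(cmod (a + b))\<^sup>2 \<le> (1 + t) * (cmod a)\<^sup>2 + (1 + 1 / t) * (cmod b)\<^sup>2"
proof -
  have "(cmod (a + b))\<^sup>2 \<le> (cmod a + cmod b)\<^sup>2"
    by (intro power_mono norm_triangle_ineq) auto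
  also have "\<dots> = (cmod a)\<^sup>2 + (cmod b)\<^sup>2 + 2 * (cmod a * cmod b)"
    by (simp add: power2_eq_square algebra_simps)
  also have "2 * (cmod a * cmod b) \<le> t * (cmod a)\<^sup>2 + (cmod b)\<^sup>2 / t"
  proof -
    have "0 \<le> (t * cmod a - cmod b)\<^sup>2 / t" using assms by simp
    also have "\<dots> = t * (cmod a)\<^sup>2 + (cmod b)\<^sup>2 / t - 2 * (cmod a * cmod b)"
      using assms by (simp add: field_simps power2_eq_square)
    finally show ?thesis by simp
  qed
  finally show ?thesis by (simp add: algebra_simps)
qed

lemma term_add_le:
  assumes "t > 0" "k \<in> I"
  shows "(cmod (a k + b k))\<^sup>2 * inverse (rr k)
     \<le> (1 + t) * ((cmod (a k))\<^sup>2 * inverse (rr k)) + (1 + 1 / t) * ((cmod (b k))\<^sup>2 * inverse (rr k))"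
  using mult_right_mono[OF cmod_add_sq[OF assms(1), of "a k" "b k"], of "inverse (rr k)"] rr_pos[OF assms(2)]
  by (simp add: algebra_simps)

lemma W_add: assumes "a \<in> W" "b \<in> W" shows "(\<lambda>k. a k + b k) \<in> W"
  unfolding W_def mem_Collect_eq
proof (rule summable_on_comparison_test)
  show "(\<lambda>k. (1 + 1) * ((cmod (a k))\<^sup>2 * inverse (rr k)) + (1 + 1 / 1) * ((cmod (b k))\<^sup>2 * inverse (rr k))) summable_on I"
    using assms by (intro summable_on_add summable_on_cmult_right) (auto simp: W_def)
qed (use term_add_le[of 1] term_nonneg in auto)

lemma W_scale: assumes "a \<in> W" shows "(\<lambda>k. c * a k) \<in> W"
  using summable_on_cmult_right[of "\<lambda>k. (cmod (a k))\<^sup>2 * inverse (rr k)" I "(cmod c)\<^sup>2"] assms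
  by (simp add: W_def norm_mult power_mult_distrib algebra_simps)

lemma W_zero: "(\<lambda>k. 0) \<in> W" by (simp add: W_def)

lemma W_diff: assumes "a \<in> W" "b \<in> W" shows "(\<lambda>k. a k - b k) \<in> W"
  using W_add[OF assms(1) W_scale[OF assms(2), of "-1"]] by simp

lemma W_cong: assumes "\<And>k. k \<in> I \<Longrightarrow> a k = b k" shows "a \<in> W \<longleftrightarrow> b \<in> W"
  unfolding W_def mem_Collect_eq by (rule summable_on_cong) (simp add: assms)

lemma Q_add:
  assumes "t > 0" "a \<in> W" "b \<in> W"
  shows "Q (\<lambda>k. a k + b k) \<le> (1 + t) * Q a + (1 + 1 / t) * Q b"
proof -
  have "Q (\<lambda>k. a k + b k) \<le> (\<Sum>\<^sub>\<infinity>k\<in>I. (1 + t) * ((cmod (a k))\<^sup>2 * inverse (rr k)) + (1 + 1 / t) * ((cmod (b k))\<^sup>2 * inverse (rr k)))"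
    unfolding Q_def using assms W_add[OF assms(2,3)]
    by (intro infsum_mono term_add_le summable_on_add summable_on_cmult_right) (auto simp: W_def)
  also have "\<dots> = (1 + t) * Q a + (1 + 1 / t) * Q b"
    unfolding Q_def using assms
    by (subst infsum_add) (auto simp: W_def infsum_cmult_right' intro!: summable_on_cmult_right)
  finally show ?thesis .
qed

lemma Q_nonneg: "0 \<le> Q a"
  unfolding Q_def by (intro infsum_nonneg term_nonneg)

lemma S_summable:
  assumes "a \<in> W" "b \<in> W"
  shows "(\<lambda>k. a k * cnj (b k) * of_real (inverse (rr k))) summable_on I"
proof (rule abs_summable_summable, rule summable_on_comparison_test)
  show "(\<lambda>k. (cmod (a k))\<^sup>2 * inverse (rr k) + (cmod (b k))\<^sup>2 * inverse (rr k)) summable_on I"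
    using assms by (intro summable_on_add) (auto simp: W_def)
  fix k assume k: "k \<in> I"
  have "0 \<le> (cmod (a k) - cmod (b k))\<^sup>2 + cmod (a k) * cmod (b k)" by simp
  then have "cmod (a k) * cmod (b k) \<le> (cmod (a k))\<^sup>2 + (cmod (b k))\<^sup>2"
    by (simp add: power2_eq_square algebra_simps)
  from mult_right_mono[OF this, of "inverse (rr k)"]
  show "cmod (a k * cnj (b k) * of_real (inverse (rr k))) \<le> (cmod (a k))\<^sup>2 * inverse (rr k) + (cmod (b k))\<^sup>2 * inverse (rr k)"
    using rr_pos[OF k] by (simp add: norm_mult norm_inverse algebra_simps)
qed auto

lemma S_self: "S a a = of_real (Q a)"
proof -
  have "S a a = (\<Sum>\<^sub>\<infinity>k\<in>I. of_real ((cmod (a k))\<^sup>2 * inverse (rr k)))"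
    unfolding S_def by (intro infsum_cong) (simp only: of_real_mult complex_norm_square)
  also have "\<dots> = of_real (Q a)"
    unfolding Q_def by (rule infsum_bounded_linear_strong[OF _ bounded_linear_of_real])
      (rule summable_on_bounded_linear_iff[OF bounded_linear_of_real bounded_linear_Re], simp)
  finally show ?thesis .
qed

lemma S_add: assumes "a \<in> W" "b \<in> W" "c \<in> W" shows "S (\<lambda>k. a k + b k) c = S a c + S b c"
  using infsum_add[OF S_summable[OF assms(1,3)] S_summable[OF assms(2,3)]]
  unfolding S_def by (simp only: distrib_right)

lemma S_scale: "S (\<lambda>k. z * a k) c = z * S a c"
  unfolding S_def mult.assoc by (rule infsum_cmult_right')

lemma S_cnj: "S b a = cnj (S a b)"
proof -
  have "cnj (S a b) = (\<Sum>\<^sub>\<infinity>k\<in>I. cnj (a k * cnj (b k) * of_real (inverse (rr k))))"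
    unfolding S_def by (rule infsum_cnj[symmetric])
  also have "\<dots> = S b a"
    unfolding S_def by (intro infsum_cong) (simp only: complex_cnj_mult complex_cnj_cnj complex_cnj_complex_of_real mult_ac)
  finally show ?thesis by (rule sym)
qed

lemma S_cong:
  "(\<And>k. k \<in> I \<Longrightarrow> a k = a' k) \<Longrightarrow> (\<And>k. k \<in> I \<Longrightarrow> b k = b' k) \<Longrightarrow> S a b = S a' b'"
  unfolding S_def by (intro infsum_cong) auto

lemma Q_cong: "(\<And>k. k \<in> I \<Longrightarrow> a k = b k) \<Longrightarrow> Q a = Q b"
  unfolding Q_def by (intro infsum_cong) auto

lemma Q_zero:
  assumes "a \<in> W" "Q a = 0" "k \<in> I" shows "a k = 0"
proof -
  have s: "(\<lambda>k. (cmod (a k))\<^sup>2 * inverse (rr k)) summable_on I"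
    using assms(1) by (simp add: W_def)
  have le: "(\<Sum>\<^sub>\<infinity>k\<in>I. (cmod (a k))\<^sup>2 * inverse (rr k)) \<le> 0"
    using assms(2) by (simp add: Q_def)
  have "(cmod (a k))\<^sup>2 * inverse (rr k) = 0"
    by (rule nonneg_infsum_le_0D[where f = "\<lambda>k. (cmod (a k))\<^sup>2 * inverse (rr k)", OF le s _ assms(3)])
       (rule term_nonneg)
  then show ?thesis using rr_pos[OF assms(3)] by simp
qed

lemma syn_summable:
  assumes "(\<lambda>k. cmod (c k)) summable_on I" shows "(\<lambda>k. c k * E k x) summable_on I"
  by (rule abs_summable_summable) (simp add: norm_mult E_norm assms)

lemma syn_cong: "(\<And>k. k \<in> I \<Longrightarrow> a k = b k) \<Longrightarrow> syn a = syn b"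
  unfolding syn_def by (intro restrict_ext infsum_cong) auto

lemma syn_add:
  assumes "a \<in> W" "b \<in> W"
  shows "(\<lambda>x\<in>X. syn a x + syn b x) = syn (\<lambda>k. a k + b k)"
  unfolding syn_def using syn_summable[OF W_abs[OF assms(1)]] syn_summable[OF W_abs[OF assms(2)]]
  by (intro restrict_ext) (simp add: distrib_right infsum_add)

lemma syn_scale: "(\<lambda>x\<in>X. z * syn a x) = syn (\<lambda>k. z * a k)"
  unfolding syn_def by (intro restrict_ext) (simp add: mult.assoc infsum_cmult_right')

lemma syn_diff:
  assumes "a \<in> W" "b \<in> W"
  shows "(\<lambda>x\<in>X. syn a x - syn b x) = syn (\<lambda>k. a k - b k)"
proof -
  have "(\<lambda>x\<in>X. syn a x - syn b x) = (\<lambda>x\<in>X. syn a x + (\<lambda>x\<in>X. (-1) * syn b x) x)"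
    by (intro restrict_ext) simp
  also have "\<dots> = syn (\<lambda>k. a k + (-1) * b k)"
    unfolding syn_scale by (intro syn_add W_scale assms)
  finally show ?thesis by simp
qed

lemma syn_zero: "syn (\<lambda>k. 0) = (\<lambda>x\<in>X. 0)" by (simp add: syn_def)

lemma fc_synW: "a \<in> W \<Longrightarrow> k \<in> I \<Longrightarrow> fc (syn a) k = a k"
  unfolding syn_def by (rule fc_syn) (auto intro: W_abs)

lemma ip_syn: "a \<in> W \<Longrightarrow> b \<in> W \<Longrightarrow> ip (syn a) (syn b) = S a b"
  unfolding ip_def by (intro S_cong fc_synW)

lemma norm_syn: "a \<in> W \<Longrightarrow> ip_norm ip (syn a) = sqrt (Q a)"
  by (simp add: ip_norm_def ip_syn S_self)

lemma rrE_W: "(\<lambda>k. of_real (rr k) * cnj (E k y)) \<in> W"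
proof -
  have "(\<lambda>k. (cmod (of_real (rr k) * cnj (E k y)))\<^sup>2 * inverse (rr k)) summable_on I \<longleftrightarrow> rr summable_on I"
    by (intro summable_on_cong) (use rr_pos rr_nz in \<open>simp add: norm_mult E_norm power2_eq_square\<close>)
  then show ?thesis using rr_sum by (simp add: W_def)
qed

lemma K_syn: "(\<lambda>x\<in>X. K x y) = syn (\<lambda>k. of_real (rr k) * cnj (E k y))"
  unfolding syn_def K_def by (intro restrict_ext infsum_cong) (simp add: mult_ac)

lemma ip_K:
  "ip f (\<lambda>x\<in>X. K x y) = (\<Sum>\<^sub>\<infinity>k\<in>I. fc f k * E k y)"
proof -
  have "ip f (\<lambda>x\<in>X. K x y) = S (fc f) (\<lambda>k. of_real (rr k) * cnj (E k y))"
    unfolding ip_def K_syn by (intro S_cong fc_synW rrE_W) auto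
  also have "\<dots> = (\<Sum>\<^sub>\<infinity>k\<in>I. fc f k * E k y)"
    unfolding S_def by (intro infsum_cong) (simp add: rr_nz)
  finally show ?thesis .
qed

lemma complete_H0: "ip_complete X (syn ` W) ip"
  unfolding ip_complete_def
proof (intro allI impI, elim conjE)
  fix F :: "nat \<Rightarrow> 'a \<Rightarrow> complex"
  assume F: "\<forall>n. F n \<in> syn ` W"
    and C: "\<forall>e>0. \<exists>n0. \<forall>m\<ge>n0. \<forall>n\<ge>n0. ip_norm ip (\<lambda>x\<in>X. F m x - F n x) < e"
  from F have "\<forall>n. \<exists>a. a \<in> W \<and> F n = syn a" by auto
  then obtain a where a: "\<And>n. a n \<in> W" "\<And>n. F n = syn (a n)" by metis
  have dW: "(\<lambda>k. a m k - a n k) \<in> W" for m n by (intro W_diff a)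
  have nrm: "ip_norm ip (\<lambda>x\<in>X. F m x - F n x) = sqrt (Q (\<lambda>k. a m k - a n k))" for m n
    using a dW by (simp add: syn_diff norm_syn)
  have C': "\<exists>n0. \<forall>m\<ge>n0. \<forall>n\<ge>n0. Q (\<lambda>k. a m k - a n k) < e" if e: "e > 0" for e
  proof -
    obtain n0 where "\<forall>m\<ge>n0. \<forall>n\<ge>n0. sqrt (Q (\<lambda>k. a m k - a n k)) < sqrt e"
      using C e unfolding nrm by (meson real_sqrt_gt_zero)
    then show ?thesis by auto
  qed
  have fin: "(\<Sum>k\<in>A. (cmod (a m k - a n k))\<^sup>2 * inverse (rr k)) \<le> Q (\<lambda>k. a m k - a n k)"
    if "finite A" "A \<subseteq> I" for A m n
    unfolding Q_def using dW[of m n] that term_nonneg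
    by (intro finite_sum_le_infsum) (auto simp: W_def)
  have "\<exists>l. (\<lambda>n. a n k) \<longlonglongrightarrow> l" if k: "k \<in> I" for k
  proof -
    have "Cauchy (\<lambda>n. a n k)"
    proof (rule metric_CauchyI)
      fix e :: real assume e: "e > 0"
      obtain n0 where n0: "\<forall>m\<ge>n0. \<forall>n\<ge>n0. Q (\<lambda>k. a m k - a n k) < e\<^sup>2 * inverse (rr k)"
        using C'[of "e\<^sup>2 * inverse (rr k)"] e rr_pos[OF k] by (metis mult_pos_pos zero_less_power positive_imp_inverse_positive)
      have "dist (a m k) (a n k) < e" if "m \<ge> n0" "n \<ge> n0" for m n
      proof -
        have "(cmod (a m k - a n k))\<^sup>2 * inverse (rr k) < e\<^sup>2 * inverse (rr k)"
          using fin[of "{k}" m n] k n0 that by fastforce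
        then have "(cmod (a m k - a n k))\<^sup>2 < e\<^sup>2" using rr_pos[OF k] by simp
        then show ?thesis using e by (simp add: dist_norm power2_less_imp_less)
      qed
      then show "\<exists>M. \<forall>m\<ge>M. \<forall>n\<ge>M. dist (a m k) (a n k) < e" by blast
    qed
    then show ?thesis by (simp add: Cauchy_convergent_iff convergent_def)
  qed
  then obtain b where b: "\<And>k. k \<in> I \<Longrightarrow> (\<lambda>n. a n k) \<longlonglongrightarrow> b k" by metis
  have est: "\<exists>n0. \<forall>n\<ge>n0. (\<lambda>k. b k - a n k) \<in> W \<and> Q (\<lambda>k. b k - a n k) \<le> e" if e: "e > 0" for e
  proof -
    obtain n0 where n0: "\<forall>m\<ge>n0. \<forall>n\<ge>n0. Q (\<lambda>k. a m k - a n k) < e" using C'[OF e] by blast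
    have "(\<lambda>k. b k - a n k) \<in> W \<and> Q (\<lambda>k. b k - a n k) \<le> e" if n: "n \<ge> n0" for n
    proof -
      have le: "(\<Sum>k\<in>A. (cmod (b k - a n k))\<^sup>2 * inverse (rr k)) \<le> e" if A: "finite A" "A \<subseteq> I" for A
      proof (rule LIMSEQ_le_const2)
        show "(\<lambda>m. \<Sum>k\<in>A. (cmod (a m k - a n k))\<^sup>2 * inverse (rr k))
                \<longlonglongrightarrow> (\<Sum>k\<in>A. (cmod (b k - a n k))\<^sup>2 * inverse (rr k))"
          using A by (intro tendsto_intros b) auto
        show "\<exists>N. \<forall>m\<ge>N. (\<Sum>k\<in>A. (cmod (a m k - a n k))\<^sup>2 * inverse (rr k)) \<le> e"
          using fin[OF A] n0 n by (meson less_imp_le order_trans)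
      qed
      have s: "(\<lambda>k. (cmod (b k - a n k))\<^sup>2 * inverse (rr k)) summable_on I"
        by (rule nonneg_bdd_above_summable_on) (use le term_nonneg in \<open>auto intro!: bdd_aboveI[where M = e]\<close>)
      moreover have "(\<Sum>\<^sub>\<infinity>k\<in>I. (cmod (b k - a n k))\<^sup>2 * inverse (rr k)) \<le> e"
        by (rule infsum_le_finite_sums[OF s]) (use le in auto)
      ultimately show ?thesis by (simp add: W_def Q_def)
    qed
    then show ?thesis by blast
  qed
  obtain n1 where "(\<lambda>k. b k - a n1 k) \<in> W" using est[of 1] by auto
  from W_add[OF this a(1)[of n1]] have bW: "b \<in> W" by simp
  have n2: "ip_norm ip (\<lambda>x\<in>X. F n x - syn b x) = sqrt (Q (\<lambda>k. b k - a n k))" for n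
  proof -
    have "ip_norm ip (\<lambda>x\<in>X. F n x - syn b x) = sqrt (Q (\<lambda>k. a n k - b k))"
      using a bW by (simp add: syn_diff norm_syn W_diff)
    also have "Q (\<lambda>k. a n k - b k) = Q (\<lambda>k. b k - a n k)" by (simp add: Q_def norm_minus_commute)
    finally show ?thesis .
  qed
  have "(\<lambda>n. Q (\<lambda>k. b k - a n k)) \<longlonglongrightarrow> 0"
  proof (rule LIMSEQ_I)
    fix e :: real assume "e > 0"
    then obtain n0 where "\<forall>n\<ge>n0. Q (\<lambda>k. b k - a n k) \<le> e / 2" using est[of "e/2"] by auto
    then show "\<exists>n0. \<forall>n\<ge>n0. norm (Q (\<lambda>k. b k - a n k) - 0) < e"
      using \<open>e > 0\<close> Q_nonneg by (intro exI[of _ n0]) (auto intro: le_less_trans[where y = "e/2"])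
  qed
  from tendsto_real_sqrt[OF this] have "(\<lambda>n. ip_norm ip (\<lambda>x\<in>X. F n x - syn b x)) \<longlonglongrightarrow> 0"
    unfolding n2 by simp
  with bW show "\<exists>f\<in>syn ` W. (\<lambda>n. ip_norm ip (\<lambda>x\<in>X. F n x - f x)) \<longlonglongrightarrow> 0" by blast
qed

lemma rkhs_H0: "is_rkhs X (syn ` W) ip K"
  unfolding is_rkhs_def
proof (intro conjI ballI)
  show "fun_space X (syn ` W)"
    unfolding fun_space_def
  proof (intro conjI ballI allI)
    show "syn ` W \<subseteq> extensional X" by (auto simp: syn_def)
    show "(\<lambda>x\<in>X. 0) \<in> syn ` W" using W_zero syn_zero by (metis imageI)
  qed (auto simp: syn_add syn_scale intro!: imageI W_add W_scale)
  show "inner_product_on X (syn ` W) ip"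
    unfolding inner_product_on_def
  proof (intro conjI ballI allI impI)
    show "ip f f = 0 \<Longrightarrow> f = (\<lambda>x\<in>X. 0)" if "f \<in> syn ` W" for f
    proof -
      assume 0: "ip f f = 0"
      from that obtain a where a: "a \<in> W" "f = syn a" by auto
      then have "Q a = 0" using 0 by (simp add: ip_syn S_self)
      then have "syn a = syn (\<lambda>k. 0)" using Q_zero[OF a(1)] by (intro syn_cong) auto
      then show ?thesis using a syn_zero by simp
    qed
    show "ip g f = cnj (ip f g)" for f g unfolding ip_def by (rule S_cnj)
  qed (auto simp: syn_add syn_scale W_add W_scale ip_syn S_add S_scale S_self Q_nonneg)
  show "ip_complete X (syn ` W) ip" by (rule complete_H0)
  fix y assume y: "y \<in> X"
  show "(\<lambda>x\<in>X. K x y) \<in> syn ` W" unfolding K_syn by (intro imageI rrE_W)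
  fix f assume "f \<in> syn ` W"
  then obtain a where a: "a \<in> W" "f = syn a" by auto
  have "ip f (\<lambda>x\<in>X. K x y) = (\<Sum>\<^sub>\<infinity>k\<in>I. a k * E k y)"
    unfolding ip_K a(2) by (intro infsum_cong) (simp add: fc_synW a)
  then show "ip f (\<lambda>x\<in>X. K x y) = f y" using y by (simp add: a syn_def)
qed

lemma rkhs_sub:
  assumes H: "is_rkhs X H ip K" shows "H \<subseteq> syn ` W"
proof
  fix f assume f: "f \<in> H"
  have ext: "f \<in> extensional X" using f H by (auto simp: is_rkhs_def fun_space_def)
  have "f y = (\<Sum>\<^sub>\<infinity>k\<in>I. fc f k * E k y)" if "y \<in> X" for y
  proof -
    have "ip f (\<lambda>x\<in>X. K x y) = f y" using H f that unfolding is_rkhs_def by blast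
    then show ?thesis by (simp only: ip_K)
  qed
  then have eq: "f = syn (fc f)"
    unfolding syn_def by (intro extensionalityI[OF ext restrict_extensional]) simp
  show "f \<in> syn ` W"
  proof (cases "f = (\<lambda>x\<in>X. 0)")
    case True then show ?thesis using W_zero syn_zero by (metis imageI)
  next
    case False
    then have "ip f f \<noteq> 0" using H f unfolding is_rkhs_def inner_product_on_def by blast
    then have "Q (fc f) \<noteq> 0" by (simp add: ip_def S_self)
    then have "fc f \<in> W" unfolding Q_def W_def using infsum_not_exists by blast
    then show ?thesis using eq by blast
  qed
qed

lemma Q_parallel:
  assumes "a \<in> W" "b \<in> W"
  shows "Q (\<lambda>k. a k + b k) + Q (\<lambda>k. a k - b k) = 2 * Q a + 2 * Q b"
proof -
  note s = assms W_add[OF assms] W_diff[OF assms]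
  have "Q (\<lambda>k. a k + b k) + Q (\<lambda>k. a k - b k) =
     (\<Sum>\<^sub>\<infinity>k\<in>I. (cmod (a k + b k))\<^sup>2 * inverse (rr k) + (cmod (a k - b k))\<^sup>2 * inverse (rr k))"
    unfolding Q_def using s by (subst infsum_add) (auto simp: W_def)
  also have "\<dots> = (\<Sum>\<^sub>\<infinity>k\<in>I. 2 * ((cmod (a k))\<^sup>2 * inverse (rr k)) + 2 * ((cmod (b k))\<^sup>2 * inverse (rr k)))"
  proof (intro infsum_cong)
    fix k
    have "(cmod (a k + b k))\<^sup>2 + (cmod (a k - b k))\<^sup>2 = 2 * (cmod (a k))\<^sup>2 + 2 * (cmod (b k))\<^sup>2"
      unfolding cmod_power2 by (simp add: power2_eq_square algebra_simps)
    from arg_cong[OF this, of "\<lambda>z. z * inverse (rr k)"]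
    show "(cmod (a k + b k))\<^sup>2 * inverse (rr k) + (cmod (a k - b k))\<^sup>2 * inverse (rr k)
        = 2 * ((cmod (a k))\<^sup>2 * inverse (rr k)) + 2 * ((cmod (b k))\<^sup>2 * inverse (rr k))"
      by (simp only: distrib_right mult.assoc)
  qed
  also have "\<dots> = 2 * Q a + 2 * Q b"
    unfolding Q_def using s by (subst infsum_add) (auto simp: W_def infsum_cmult_right' intro!: summable_on_cmult_right)
  finally show ?thesis .
qed

lemma Q_scale: "Q (\<lambda>k. c * a k) = (cmod c)\<^sup>2 * Q a"
  unfolding Q_def by (simp add: norm_mult power_mult_distrib mult.assoc infsum_cmult_right')

lemma Q_expand:
  assumes "a \<in> W" "b \<in> W"
  shows "Q (\<lambda>k. a k - c * b k) = Q a - 2 * Re (cnj c * S a b) + (cmod c)\<^sup>2 * Q b"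
proof -
  have cb: "(\<lambda>k. (- c) * b k) \<in> W" by (intro W_scale assms)
  define u where "u = (\<lambda>k. a k - c * b k)"
  have uW: "u \<in> W" unfolding u_def by (intro W_diff W_scale assms)
  have 1: "S u x = S a x - c * S b x" if "x \<in> W" for x
    using S_add[OF assms(1) cb that] S_scale[of "-c" b x] by (simp add: u_def)
  have 2: "S x u = S x a - cnj c * S x b" if "x \<in> W" for x
  proof -
    have "S x u = cnj (S u x)" by (rule S_cnj)
    also have "\<dots> = cnj (S a x) - cnj c * cnj (S b x)" by (simp add: 1[OF that])
    also have "cnj (S a x) = S x a" by (rule S_cnj[symmetric])
    also have "cnj (S b x) = S x b" by (rule S_cnj[symmetric])
    finally show ?thesis .
  qed
  have ba: "S b a = cnj (S a b)" by (rule S_cnj)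
  have "of_real (Q u) = S u u" by (rule S_self[symmetric])
  also have "\<dots> = S a u - c * S b u" by (rule 1[OF uW])
  also have "\<dots> = (S a a - cnj c * S a b) - c * (S b a - cnj c * S b b)"
    by (simp only: 2[OF assms(1)] 2[OF assms(2)])
  also have "\<dots> = of_real (Q a) - cnj c * S a b - cnj (cnj c * S a b) + c * cnj c * of_real (Q b)"
    unfolding ba S_self by (simp add: algebra_simps)
  finally have "Re (of_real (Q u)) = Re (of_real (Q a) - cnj c * S a b - cnj (cnj c * S a b) + c * cnj c * of_real (Q b))"
    by (rule arg_cong)
  also have "c * cnj c = of_real ((cmod c)\<^sup>2)" by (rule complex_norm_square[symmetric])
  finally have "Q u = Q a - 2 * Re (cnj c * S a b) + (cmod c)\<^sup>2 * Q b"
    by (simp del: of_real_power)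
  then show ?thesis by (simp add: u_def)
qed

lemma rkhs_sup:
  assumes H: "is_rkhs X H ip K" shows "syn ` W \<subseteq> H"
proof
  fix f assume "f \<in> syn ` W"
  then obtain a where a: "a \<in> W" "f = syn a" by auto
  define V where "V = {b \<in> W. syn b \<in> H}"
  have VW: "b \<in> W" if "b \<in> V" for b using that by (simp add: V_def)
  have fs: "fun_space X H" using H by (simp add: is_rkhs_def)
  have Vadd: "(\<lambda>k. b k + c k) \<in> V" if "b \<in> V" "c \<in> V" for b c
    using that fs by (auto simp: V_def W_add syn_add[symmetric] fun_space_def)
  have Vscale: "(\<lambda>k. z * b k) \<in> V" if "b \<in> V" for b z
    using that fs by (auto simp: V_def W_scale syn_scale[symmetric] fun_space_def)
  have V0: "(\<lambda>k. 0) \<in> V" using fs by (auto simp: V_def W_zero syn_zero fun_space_def)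
  define D where "D = (\<lambda>b. Q (\<lambda>k. a k - b k)) ` V"
  define \<delta> where "\<delta> = Inf D"
  have Dbd: "bdd_below D" unfolding D_def by (rule bdd_belowI[of _ 0]) (auto simp: Q_nonneg)
  have \<delta>_le: "\<delta> \<le> Q (\<lambda>k. a k - b k)" if "b \<in> V" for b
    unfolding \<delta>_def using Dbd that by (intro cInf_lower) (auto simp: D_def)
  have "\<exists>b\<in>V. Q (\<lambda>k. a k - b k) < \<delta> + 1 / real (Suc n)" for n
  proof -
    have "D \<noteq> {}" using V0 by (auto simp: D_def)
    from cInf_lessD[OF this, of "\<delta> + 1 / real (Suc n)"] show ?thesis by (auto simp: \<delta>_def D_def)
  qed
  then obtain h where h: "\<And>n. h n \<in> V" "\<And>n. Q (\<lambda>k. a k - h n k) < \<delta> + 1 / real (Suc n)" by metis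
  have hW: "h n \<in> W" for n using h VW by blast
  have cau: "Q (\<lambda>k. h m k - h n k) \<le> 2 / real (Suc m) + 2 / real (Suc n)" for m n
  proof -
    let ?u = "\<lambda>k. a k - h n k" and ?v = "\<lambda>k. a k - h m k"
    have uv: "?u \<in> W" "?v \<in> W" by (intro W_diff a hW)+
    have "(\<lambda>k. (1/2) * (h n k + h m k)) \<in> V" by (intro Vscale Vadd h)
    from \<delta>_le[OF this] have "4 * \<delta> \<le> 4 * Q (\<lambda>k. a k - (1/2) * (h n k + h m k))" by simp
    also have "\<dots> = Q (\<lambda>k. 2 * (a k - (1/2) * (h n k + h m k)))" by (subst Q_scale) simp
    also have "\<dots> = Q (\<lambda>k. ?u k + ?v k)" by (simp add: algebra_simps)
    finally have "4 * \<delta> \<le> Q (\<lambda>k. ?u k + ?v k)" .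
    moreover have "Q (\<lambda>k. ?u k - ?v k) = Q (\<lambda>k. h m k - h n k)" by simp
    moreover have "2 / real (Suc m) = 2 * (1 / real (Suc m))" "2 / real (Suc n) = 2 * (1 / real (Suc n))"
      by simp_all
    ultimately show ?thesis using Q_parallel[OF uv] h(2)[of n] h(2)[of m] by linarith
  qed
  have nrm: "ip_norm ip (\<lambda>x\<in>X. syn b x - syn c x) = sqrt (Q (\<lambda>k. b k - c k))" if "b \<in> W" "c \<in> W" for b c
    using that by (simp add: syn_diff norm_syn W_diff)
  have "\<exists>g\<in>H. (\<lambda>n. ip_norm ip (\<lambda>x\<in>X. syn (h n) x - g x)) \<longlonglongrightarrow> 0"
  proof -
    have "\<exists>n0. \<forall>m\<ge>n0. \<forall>n\<ge>n0. ip_norm ip (\<lambda>x\<in>X. syn (h m) x - syn (h n) x) < e" if e: "e > 0" for e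
    proof -
      obtain n0 where n0: "inverse (real (Suc n0)) < e\<^sup>2 / 4"
        using reals_Archimedean[of "e\<^sup>2 / 4"] e by auto
      have "ip_norm ip (\<lambda>x\<in>X. syn (h m) x - syn (h n) x) < e" if "m \<ge> n0" "n \<ge> n0" for m n
      proof -
        have "1 / real (Suc m) \<le> inverse (real (Suc n0))" "1 / real (Suc n) \<le> inverse (real (Suc n0))"
          using that by (auto simp: field_simps)
        then have "Q (\<lambda>k. h m k - h n k) < e\<^sup>2" using cau[of m n] n0 by simp
        then have "sqrt (Q (\<lambda>k. h m k - h n k)) < e" using e by (intro real_less_lsqrt) auto
        then show ?thesis using nrm hW by simp
      qed
      then show ?thesis by blast
    qed
    moreover have "\<forall>n. syn (h n) \<in> H" using h by (simp add: V_def)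
    moreover have "ip_complete X H ip" using H by (simp add: is_rkhs_def)
    ultimately show ?thesis unfolding ip_complete_def by (elim allE[of _ "\<lambda>n. syn (h n)"]) auto
  qed
  then obtain g where g: "g \<in> H" "(\<lambda>n. ip_norm ip (\<lambda>x\<in>X. syn (h n) x - g x)) \<longlonglongrightarrow> 0" by blast
  obtain b where b: "b \<in> W" "g = syn b" using rkhs_sub[OF H] g by blast
  have bV: "b \<in> V" using b g by (simp add: V_def)
  have lim: "(\<lambda>n. Q (\<lambda>k. h n k - b k)) \<longlonglongrightarrow> 0"
    using tendsto_power[OF g(2), of 2] unfolding b(2) nrm[OF hW b(1)] by (simp add: Q_nonneg)
  define u where "u = (\<lambda>k. a k - b k)"
  have uW: "u \<in> W" unfolding u_def by (intro W_diff a b)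
  have Qu: "Q u \<le> (1 + t) * \<delta>" if t: "t > 0" for t
  proof (rule LIMSEQ_le_const)
    show "(\<lambda>n. (1 + t) * (\<delta> + 1 / real (Suc n)) + (1 + 1 / t) * Q (\<lambda>k. h n k - b k)) \<longlonglongrightarrow> (1 + t) * \<delta>"
    proof -
      have "(\<lambda>n. (1 + t) * (\<delta> + 1 / real (Suc n)) + (1 + 1 / t) * Q (\<lambda>k. h n k - b k))
              \<longlonglongrightarrow> (1 + t) * (\<delta> + 0) + (1 + 1 / t) * 0"
        by (intro tendsto_intros lim LIMSEQ_Suc[OF lim_1_over_n])
      then show ?thesis by simp
    qed
    have "Q u \<le> (1 + t) * (\<delta> + 1 / real (Suc n)) + (1 + 1 / t) * Q (\<lambda>k. h n k - b k)" for n
    proof -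
      have "Q u = Q (\<lambda>k. (a k - h n k) + (h n k - b k))" by (simp add: u_def)
      also have "\<dots> \<le> (1 + t) * Q (\<lambda>k. a k - h n k) + (1 + 1 / t) * Q (\<lambda>k. h n k - b k)"
        by (intro Q_add t W_diff a b hW)
      also have "\<dots> \<le> (1 + t) * (\<delta> + 1 / real (Suc n)) + (1 + 1 / t) * Q (\<lambda>k. h n k - b k)"
        using h(2)[of n] t by (intro add_right_mono mult_left_mono) auto
      finally show ?thesis .
    qed
    then show "\<exists>N. \<forall>n\<ge>N. Q u \<le> (1 + t) * (\<delta> + 1 / real (Suc n)) + (1 + 1 / t) * Q (\<lambda>k. h n k - b k)" by blast
  qed
  have Qu': "Q u \<le> \<delta>"
  proof (rule tendsto_lowerbound)
    show "((\<lambda>t. (1 + t) * \<delta>) \<longlongrightarrow> \<delta>) (at_right 0)"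
      by (rule tendsto_eq_intros refl | simp)+
    show "\<forall>\<^sub>F t in at_right 0. Q u \<le> (1 + t) * \<delta>"
      using Qu by (auto simp: eventually_at_right_field intro: exI[of _ 1])
  qed simp
  have orth: "S u c = 0" if c: "c \<in> V" for c
  proof (rule ccontr)
    assume nz: "S u c \<noteq> 0"
    let ?z = "S u c"
    define t where "t = 1 / (Q c + 1)"
    have t: "t > 0" using Q_nonneg[of c] by (simp add: t_def)
    have "(\<lambda>k. b k + (of_real t * ?z) * c k) \<in> V" by (intro Vadd Vscale bV c)
    from \<delta>_le[OF this] have "Q u \<le> Q (\<lambda>k. u k - (of_real t * ?z) * c k)"
      using Qu' by (simp add: u_def algebra_simps)
    also have "\<dots> = Q u - 2 * t * (cmod ?z)\<^sup>2 + t\<^sup>2 * (cmod ?z)\<^sup>2 * Q c"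
    proof -
      have "cnj (of_real t * ?z) * ?z = of_real (t * (cmod ?z)\<^sup>2)"
        by (simp only: of_real_mult complex_norm_square complex_cnj_mult complex_cnj_complex_of_real mult_ac)
      then have "Re (cnj (of_real t * ?z) * ?z) = t * (cmod ?z)\<^sup>2" by (simp only: Re_complex_of_real)
      moreover have "(cmod (of_real t * ?z))\<^sup>2 = t\<^sup>2 * (cmod ?z)\<^sup>2"
        by (simp add: norm_mult power_mult_distrib)
      ultimately show ?thesis using Q_expand[OF uW VW[OF c], of "of_real t * ?z"] by simp
    qed
    finally have "2 * t * (cmod ?z)\<^sup>2 \<le> t\<^sup>2 * (cmod ?z)\<^sup>2 * Q c" by simp
    also have "\<dots> = t * (cmod ?z)\<^sup>2 * (t * Q c)" by (simp add: power2_eq_square)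
    also have "\<dots> \<le> t * (cmod ?z)\<^sup>2 * 1"
      using t Q_nonneg[of c] by (intro mult_left_mono) (auto simp: t_def field_simps)
    finally show False using t nz by simp
  qed
  have "syn u y = 0" if y: "y \<in> X" for y
  proof -
    have K: "(\<lambda>k. of_real (rr k) * cnj (E k y)) \<in> V"
      using H y rrE_W unfolding V_def K_syn[symmetric] by (simp add: is_rkhs_def K_syn[symmetric])
    have "syn u y = ip (syn u) (\<lambda>x\<in>X. K x y)"
      using rkhs_H0 y uW by (auto simp: is_rkhs_def)
    also have "\<dots> = S u (\<lambda>k. of_real (rr k) * cnj (E k y))" unfolding K_syn by (intro ip_syn uW rrE_W)
    also have "\<dots> = 0" by (rule orth[OF K])
    finally show ?thesis .
  qed
  then have "syn a x = syn b x" if "x \<in> X" for x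
    using that fun_cong[OF syn_diff[OF a(1) b(1)], of x] by (simp add: u_def)
  then have "f = g" unfolding a b by (auto simp: syn_def fun_eq_iff)
  then show "f \<in> H" using g(1) by simp
qed

theorem rkhs_iff: "is_rkhs X H ip K \<longleftrightarrow> H = syn ` W"
  using rkhs_H0 rkhs_sub rkhs_sup by blast

end


subsection \<open>The Fourier system on the unit cube\<close>

lemma dot_restrict: "index_dot d k (\<lambda>j. x j - y j) = index_dot d k x - index_dot d k y"
  by (simp add: index_dot_def sum_subtractf algebra_simps)

lemma cis_index_dot: "cis (2 * pi * index_dot d k x) = (\<Prod>j=1..d. cis (2 * pi * (of_int (k j) * x j)))"
proof -
  have *: "cis (sum f A) = prod (\<lambda>j. cis (f j)) A" if "finite A" for f :: "nat \<Rightarrow> real" and A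
    using that by (induction A rule: finite_induct) (auto simp: cis_mult[symmetric])
  show ?thesis unfolding index_dot_def sum_distrib_left by (rule *) simp
qed

lemma interval_cis_integral:
  "(\<integral>t. cis (2 * pi * (of_int m * t)) \<partial>restrict_space lborel {0..1}) = (if m = 0 then 1 else 0)"
proof -
  have "(\<integral>t. cis (2 * pi * (of_int m * t)) \<partial>restrict_space lborel {0..1})
          = (\<integral>t. indicator {0..1} t *\<^sub>R cis (2 * pi * (of_int m * t)) \<partial>lborel)"
    by (rule integral_restrict_space) simp
  also have "\<dots> = (if m = 0 then 1 else 0)"
  proof (cases "m = 0")
    case True
    then show ?thesis by (simp add: measure_lborel_Icc)
  next
    case False
    define F where "F = (\<lambda>t. cis (2 * pi * (of_int m * t)) / (\<i> * of_real (2 * pi * of_int m)))"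
    have "(\<integral>t. indicator {0..1} t *\<^sub>R cis (2 * pi * (of_int m * t)) \<partial>lborel) = F 1 - F 0"
    proof (rule integral_FTC_atLeastAtMost)
      show "continuous_on {0..1} (\<lambda>t. cis (2 * pi * (of_int m * t)))"
        by (intro continuous_intros)
      fix t :: real
      show "(F has_vector_derivative cis (2 * pi * (of_int m * t))) (at t within {0..1})"
        unfolding F_def has_vector_derivative_def
        by (rule derivative_eq_intros refl | (use False in \<open>simp add: fun_eq_iff scaleR_conv_of_real field_simps; fail\<close>))+
    qed simp
    also have "F 1 = F 0" unfolding F_def by simp
    finally show ?thesis using False by simp
  qed
  finally show ?thesis .
qed

interpretation unit_interval: product_sigma_finite "\<lambda>j::nat. restrict_space lborel {0..1::real}"
proof (rule product_sigma_finite.intro)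
  interpret finite_measure "restrict_space lborel {0..1::real}"
    by (rule finite_measureI) (simp add: emeasure_restrict_space space_restrict_space)
  show "sigma_finite_measure (restrict_space lborel {0..1::real})" ..
qed

lemma interval_cis_integrable:
  "integrable (restrict_space lborel {0..1}) (\<lambda>t. cis (a * t))"
proof (rule integrableI_bounded_set[where A = "{0..1}" and B = 1])
  show "(\<lambda>t. cis (a * t)) \<in> borel_measurable (restrict_space lborel {0..1})"
  proof (rule measurable_restrict_space1)
    have "(\<lambda>t. cis (a * t)) \<in> borel_measurable borel"
      by (rule borel_measurable_continuous_onI) (intro continuous_intros)
    then show "(\<lambda>t. cis (a * t)) \<in> borel_measurable lborel" by simp
  qed
qed (auto simp: emeasure_restrict_space space_restrict_space sets_restrict_space)

lemma cube_cis_integral: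
  "(\<integral>x. cis (2 * pi * index_dot d k x) \<partial>cube_measure d) = (if \<forall>j\<in>{1..d}. k j = 0 then 1 else 0)"
proof -
  have "(\<integral>x. cis (2 * pi * index_dot d k x) \<partial>cube_measure d)
     = (\<Prod>j=1..d. \<integral>t. cis (2 * pi * (of_int (k j) * t)) \<partial>restrict_space lborel {0..1})"
    unfolding cis_index_dot cube_measure_def
    by (rule unit_interval.product_integral_prod)
       (use interval_cis_integrable[of "2 * pi * of_int (k j)" for j] in \<open>simp_all add: mult.assoc\<close>)
  then show ?thesis by (auto simp: interval_cis_integral)
qed

lemma cube_cis_integrable: "integrable (cube_measure d) (\<lambda>x. cis (2 * pi * index_dot d k x))"
  unfolding cis_index_dot cube_measure_def
  by (rule unit_interval.product_integrable_prod)
     (use interval_cis_integrable[of "2 * pi * of_int (k j)" for j] in \<open>simp_all add: mult.assoc\<close>)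

lemma space_cube_measure: "space (cube_measure d) = unit_cube d"
  by (simp add: cube_measure_def unit_cube_def space_PiM space_restrict_space)

lemma fourier_coeff_syn:
  assumes d: "d \<ge> 1" and c: "(\<lambda>k. cmod (c k)) summable_on multi_indices d"
    and k: "k \<in> multi_indices d"
  shows "fourier_coeff d (\<lambda>x\<in>unit_cube d. \<Sum>\<^sub>\<infinity>k\<in>multi_indices d. c k * cis (2 * pi * index_dot d k x)) k = c k"
proof -
  let ?I = "multi_indices d" and ?M = "cube_measure d"
  have "countable ?I" unfolding multi_indices_def by (intro countable_PiE) auto
  moreover have "infinite ?I"
  proof
    assume "finite ?I"
    moreover have "range (\<lambda>n. \<lambda>j\<in>{1..d}. int n) \<subseteq> ?I" by (auto simp: multi_indices_def)
    moreover have "inj (\<lambda>n. \<lambda>j\<in>{1..d}. int n)"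
    proof (rule injI)
      fix m n assume "(\<lambda>j\<in>{1..d}. int m) = (\<lambda>j\<in>{1..d}. int n)"
      from fun_cong[OF this, of 1] d show "m = n" by simp
    qed
    ultimately show False by (metis finite_imageD finite_subset infinite_UNIV_nat)
  qed
  ultimately obtain b where b: "bij_betw b (UNIV :: nat set) ?I" using bij_betw_from_nat_into by blast
  have b_mem: "b n \<in> ?I" for n using b by (auto simp: bij_betw_def)
  let ?E = "\<lambda>k x. cis (2 * pi * index_dot d k x)"
  have cb: "(\<lambda>n. cmod (c (b n))) summable_on UNIV"
    using summable_on_reindex_bij_betw[OF b, of "\<lambda>k. cmod (c k)"] c by simp
  then have cb': "summable (\<lambda>n. cmod (c (b n)))" by (rule summable_on_imp_summable)
  have ser: "(\<Sum>\<^sub>\<infinity>k\<in>?I. c k * ?E k x) = (\<Sum>n. c (b n) * ?E (b n) x)" for x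
  proof -
    have "(\<Sum>\<^sub>\<infinity>k\<in>?I. c k * ?E k x) = (\<Sum>\<^sub>\<infinity>n\<in>UNIV. c (b n) * ?E (b n) x)"
      by (rule infsum_reindex_bij_betw[OF b, symmetric])
    also have "(\<lambda>n. c (b n) * ?E (b n) x) summable_on UNIV"
      by (rule abs_summable_summable[of "\<lambda>n. c (b n) * ?E (b n) x"]) (use cb in \<open>simp add: norm_mult\<close>)
    then have "(\<lambda>n. c (b n) * ?E (b n) x) sums (\<Sum>\<^sub>\<infinity>n\<in>UNIV. c (b n) * ?E (b n) x)"
      by (intro has_sum_imp_sums has_sum_infsum)
    then have "(\<Sum>\<^sub>\<infinity>n\<in>UNIV. c (b n) * ?E (b n) x) = (\<Sum>n. c (b n) * ?E (b n) x)" by (simp add: sums_iff)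
    finally show ?thesis .
  qed
  have mul: "?E l x * cis (- 2 * pi * index_dot d k x) = ?E (\<lambda>j. l j - k j) x" for l x
    by (simp add: cis_mult index_dot_def sum_subtractf algebra_simps)
  let ?f = "\<lambda>n x. c (b n) * ?E (\<lambda>j. b n j - k j) x"
  have int: "integrable ?M (?f n)" for n by (intro integrable_mult_right cube_cis_integrable)
  have one: "(\<integral>x. 1 \<partial>?M) = (1 :: complex)" using cube_cis_integral[of d "\<lambda>_. 0"] by (simp add: index_dot_def)
  have meas: "measure ?M (space ?M) = 1"
  proof -
    have "complex_of_real (measure ?M (space ?M)) = 1" using one by (simp add: scaleR_conv_of_real)
    then show ?thesis by simp
  qed
  have "fourier_coeff d (\<lambda>x\<in>unit_cube d. \<Sum>\<^sub>\<infinity>k\<in>?I. c k * ?E k x) k = (\<integral>x. (\<Sum>n. ?f n x) \<partial>?M)"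
    unfolding fourier_coeff_def
  proof (rule Bochner_Integration.integral_cong[OF refl])
    fix x assume "x \<in> space ?M"
    then have "x \<in> unit_cube d" by (simp add: space_cube_measure)
    then have "(\<lambda>x\<in>unit_cube d. \<Sum>\<^sub>\<infinity>k\<in>?I. c k * ?E k x) x * cis (- 2 * pi * index_dot d k x)
        = (\<Sum>n. c (b n) * ?E (b n) x) * cis (- 2 * pi * index_dot d k x)" by (simp add: ser)
    also have "\<dots> = (\<Sum>n. (c (b n) * ?E (b n) x) * cis (- 2 * pi * index_dot d k x))"
      by (rule suminf_mult2, rule summable_norm_cancel) (use cb' in \<open>simp add: norm_mult\<close>)
    also have "\<dots> = (\<Sum>n. ?f n x)"
      by (intro arg_cong[where f = suminf] ext) (simp only: mult.assoc[of "c (b n)" for n] mul)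
    finally show "(\<lambda>x\<in>unit_cube d. \<Sum>\<^sub>\<infinity>k\<in>?I. c k * ?E k x) x * cis (- 2 * pi * index_dot d k x) = (\<Sum>n. ?f n x)" .
  qed
  also have "\<dots> = (\<Sum>n. \<integral>x. ?f n x \<partial>?M)"
    by (rule integral_suminf[OF int]) (use cb' in \<open>simp_all add: norm_mult meas\<close>)
  also have "\<dots> = (\<Sum>n. if b n = k then c k else 0)"
  proof (rule arg_cong[where f = suminf], rule ext)
    fix n
    have "(\<forall>j\<in>{1..d}. b n j - k j = 0) \<longleftrightarrow> b n = k"
    proof -
      have ext: "b n \<in> extensional {1..d}" "k \<in> extensional {1..d}"
        using b_mem[of n] k by (auto simp: multi_indices_def PiE_def)
      show ?thesis by (auto intro!: extensionalityI[OF ext])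
    qed
    then show "(\<integral>x. ?f n x \<partial>?M) = (if b n = k then c k else 0)"
      by (auto simp: cube_cis_integral)
  qed
  also have "\<dots> = c k"
  proof -
    obtain n0 where n0: "b n0 = k" using b k unfolding bij_betw_def by (metis imageE)
    have "b n = k \<longleftrightarrow> n = n0" for n using b n0 by (auto simp: bij_betw_def inj_eq)
    then show ?thesis using suminf_finite[of "{n0}" "\<lambda>n. if b n = k then c k else 0"] by auto
  qed
  finally show ?thesis .
qed

lemma r1_weight_pos:
  assumes "\<gamma> > 0" "\<kappa> > 1" shows "0 < r1_weight \<mu> \<kappa> \<gamma> k"
proof (cases "k = 0")
  case False
  then have "1 \<le> \<bar>real_of_int k\<bar>" by linarith
  then have "1 * 1 < \<kappa> * \<bar>real_of_int k\<bar>" using assms by (intro mult_less_le_imp_less) auto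
  then show ?thesis using False assms by (simp add: r1_weight_def)
qed (simp add: r1_weight_def)

lemma r1_weight_summable:
  assumes "\<mu> > 1" "\<gamma> > 0" "\<kappa> > 1" shows "r1_weight \<mu> \<kappa> \<gamma> summable_on UNIV"
proof -
  define f where "f = (\<lambda>n::nat. inverse (real n) * ln (\<kappa> * real n) powr (- \<mu>))"
  have gt1: "1 < \<kappa> * real n" if "n > 0" for n
    using mult_less_le_imp_less[of 1 \<kappa> 1 "real n"] that assms by simp
  have "summable f \<longleftrightarrow> summable (\<lambda>n. 2 ^ n * f (2 ^ n))"
  proof (rule condensation_test)
    show "0 \<le> f n" for n by (simp add: f_def)
    fix m :: nat assume m: "0 < m"
    define n where "n = Suc m"
    have mn: "0 < m" "m \<le> n" using m by (auto simp: n_def)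
    have "ln (\<kappa> * real m) \<le> ln (\<kappa> * real n)" using gt1[of m] mn assms by (subst ln_le_cancel_iff) auto
    moreover have "0 < ln (\<kappa> * real m)" using gt1[of m] mn by simp
    ultimately have "ln (\<kappa> * real n) powr (-\<mu>) \<le> ln (\<kappa> * real m) powr (-\<mu>)"
      using assms by (intro powr_mono2') auto
    then show "f (Suc m) \<le> f m" unfolding f_def n_def[symmetric] using mn by (intro mult_mono) (auto simp: field_simps)
  qed
  moreover have "summable (\<lambda>n. 2 ^ n * f (2 ^ n))"
  proof (rule summable_comparison_test_ev)
    show "summable (\<lambda>n. ln 2 powr (-\<mu>) * real n powr (-\<mu>))"
      using assms by (intro summable_mult) (simp add: summable_real_powr_iff)
    show "\<forall>\<^sub>F n in sequentially. norm (2 ^ n * f (2 ^ n)) \<le> ln 2 powr (-\<mu>) * real n powr (-\<mu>)"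
      using eventually_gt_at_top[of 0]
    proof eventually_elim
      case (elim n)
      have "norm (2 ^ n * f (2 ^ n)) = ln (\<kappa> * 2 ^ n) powr (-\<mu>)" by (simp add: f_def)
      also have "\<dots> \<le> (ln 2 * real n) powr (-\<mu>)"
        using assms elim by (intro powr_mono2') (auto simp: ln_mult ln_realpow)
      also have "\<dots> = ln 2 powr (-\<mu>) * real n powr (-\<mu>)" by (simp add: powr_mult)
      finally show ?case .
    qed
  qed
  ultimately have sf: "summable f" by simp
  have fs: "f summable_on A" for A
  proof (rule summable_on_subset_banach[OF _ subset_UNIV])
    show "f summable_on UNIV"
      by (rule norm_summable_imp_summable_on) (use sf in \<open>simp add: f_def\<close>)
  qed
  have "(\<lambda>k. \<gamma> * f (nat \<bar>k\<bar>)) summable_on {1..}"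
  proof (rule summable_on_cmult_right)
    have "bij_betw int {1..} {1..}"
      by (rule bij_betwI[where g = nat]) auto
    from summable_on_reindex_bij_betw[OF this, of "\<lambda>k. f (nat \<bar>k\<bar>)"] fs[of "{1..}"]
    show "(\<lambda>k. f (nat \<bar>k\<bar>)) summable_on {1..}" by simp
  qed
  then have p: "r1_weight \<mu> \<kappa> \<gamma> summable_on {1..}"
    by (rule summable_on_cong[THEN iffD1, rotated]) (auto simp: r1_weight_def f_def)
  have n: "r1_weight \<mu> \<kappa> \<gamma> summable_on {..-1}"
  proof -
    have "bij_betw uminus {1::int..} {..-1}"
      by (rule bij_betwI[where g = uminus]) auto
    from summable_on_reindex_bij_betw[OF this, of "r1_weight \<mu> \<kappa> \<gamma>"]
    have "r1_weight \<mu> \<kappa> \<gamma> summable_on {..-1} \<longleftrightarrow> (\<lambda>k. r1_weight \<mu> \<kappa> \<gamma> (- k)) summable_on {1..}" by simp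
    also have "(\<lambda>k. r1_weight \<mu> \<kappa> \<gamma> (- k)) = r1_weight \<mu> \<kappa> \<gamma>" by (auto simp: r1_weight_def)
    finally show ?thesis using p by simp
  qed
  have "r1_weight \<mu> \<kappa> \<gamma> summable_on ({1..} \<union> {..-1} \<union> {0})"
    using p n by (intro summable_on_union) auto
  also have "{1..} \<union> {..-1} \<union> {0} = (UNIV :: int set)" by auto
  finally show ?thesis .
qed

theorem korobov_rkhs_unique:
  assumes "\<mu> > 1" "\<kappa> > 1" "d \<ge> 1" and "\<And>j. j \<ge> 1 \<Longrightarrow> \<gamma> j > 0"
  shows "\<exists>!H. is_rkhs (unit_cube d) H (korobov_ip \<mu> \<kappa> \<gamma> d) (korobov_kernel \<mu> \<kappa> \<gamma> d)"
proof -
  interpret fourier_rkhs "unit_cube d" "multi_indices d" "r_weight \<mu> \<kappa> \<gamma> d" "\<lambda>k x. cis (2 * pi * index_dot d k x)" "fourier_coeff d"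
  proof
    show pos: "0 < r_weight \<mu> \<kappa> \<gamma> d k" for k
      unfolding r_weight_def using assms by (intro prod_pos ballI r1_weight_pos) auto
    have "Infinite_Set_Sum.abs_summable_on (r1_weight \<mu> \<kappa> (\<gamma> j)) UNIV" if "j \<in> {1..d}" for j
    proof -
      have "(\<lambda>k. norm (r1_weight \<mu> \<kappa> (\<gamma> j) k)) summable_on UNIV"
        using r1_weight_summable[of \<mu> "\<gamma> j" \<kappa>] r1_weight_pos[of "\<gamma> j" \<kappa> \<mu>] assms that by (simp add: less_imp_le)
      then show ?thesis by (simp only: abs_summable_equivalent)
    qed
    then have "Infinite_Set_Sum.abs_summable_on (\<lambda>k. \<Prod>j\<in>{1..d}. r1_weight \<mu> \<kappa> (\<gamma> j) (k j)) (multi_indices d)"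
      unfolding multi_indices_def by (intro abs_summable_on_prod_PiE) auto
    then have "(\<lambda>k. norm (r_weight \<mu> \<kappa> \<gamma> d k)) summable_on multi_indices d"
      unfolding r_weight_def by (simp only: abs_summable_equivalent)
    then show "r_weight \<mu> \<kappa> \<gamma> d summable_on multi_indices d"
      using pos by (simp add: less_imp_le)
  qed (use assms fourier_coeff_syn in auto)
  have "ip = korobov_ip \<mu> \<kappa> \<gamma> d"
    by (simp add: fun_eq_iff ip_def S_def korobov_ip_def)
  moreover have "K = korobov_kernel \<mu> \<kappa> \<gamma> d"
    by (simp add: fun_eq_iff K_def korobov_kernel_def dot_restrict cis_mult cis_cnj right_diff_distrib)
  ultimately show ?thesis using rkhs_iff by metis
qed

end

theory Submission
  imports Defs
begin

text \<open>
  The squared worst-case error of a lattice rule is the sum of the weights \<open>r(k)\<close> over the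
  non-zero points \<open>k\<close> of the dual lattice (\<open>lattice_error_squared\<close>). Put \<open>a = \<mu> (1 - \<lambda>)\<close> and
  measure this sum by the gauge \<open>G(x) = x * max(2\<mu>, log(1/x))^a\<close>. It plays the role that the power
  \<open>x^\<lambda>\<close> of Jensen's inequality plays for polynomially decaying weights, and four properties
  of it carry the proof.

  Since \<open>G(x)/x\<close> does not increase, \<open>G\<close> is countably subadditive (\<open>log_gauge_infsum_le\<close>), although for
  \<open>a > 0\<close> its slope jumps up at \<open>exp(-2\<mu>)\<close>, so that it is not concave.
  Since \<open>a \<le> 2\<mu>\<close>, it is increasing (\<open>log_gauge_mono\<close>), so a component that minimises the error also minimises the gauge of its own contribution.
  The condition on \<open>\<kappa>\<close> ensures that in dimension one \<open>r(k) \<le> exp(-2\<mu>)\<close> for every \<open>k \<noteq> 0\<close>, that is,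
  \<open>log(1/r(k)) \<ge> 2\<mu> > 2\<close>. The sum of numbers that are at least 2 does not exceed their product, hence
  \<open>log(1/r(k))\<close> in dimension \<open>d\<close> is at most the product of the one-dimensional logarithms over the
  non-zero coordinates, and \<open>G(r(k))\<close> is bounded by a product of one-dimensional factors.
  Up to constants these factors are bounded by weights of the same kind, with exponent
  \<open>\<mu> - a = \<mu> \<lambda> > 1\<close> in place of \<open>\<mu>\<close>, so they are summable (\<open>log_gauge_r_weight_le\<close>). Finally
  \<open>G(x) \<le> t\<close> gives \<open>x \<le> t\<close>, and therefore \<open>x \<le> t / log(1/t)^a\<close> (\<open>le_of_log_gauge_le\<close>), which is
  the shape of the claimed bound for \<open>t = T/N\<close>.

  It remains to see that the gauge of the squared error is at most \<open>T/N\<close>, by induction on the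
  dimension. A new component adds the dual lattice points whose last coordinate \<open>m\<close> is not 0.
  By minimality the gauge of their contribution is at most its average over all generators
  \<open>1, ..., N - 1\<close>. If \<open>N\<close> does not divide \<open>m\<close>, a given frequency lies in the dual lattice for at most
  one generator, which gains the factor \<open>1/(N - 1)\<close>; if \<open>N\<close> divides \<open>m\<close>, it may do so for all of them,
  but then its weight is smaller by the factor \<open>1/N\<close>. Both factors together are at most
  \<open>3/N\<close> (\<open>cbc_step\<close>), and the products over the coordinates telescope to
  \<open>T_bound\<close> (\<open>log_gauge_dual_lattice_sum_le\<close>).
\<close>

section \<open>Interchanging finite and infinite sums\<close>

lemma has_sum_finite_sum:
  fixes f :: "'i \<Rightarrow> 'k \<Rightarrow> 'b::topological_comm_monoid_add"
  assumes "finite F" "\<And>i. i \<in> F \<Longrightarrow> (f i has_sum S i) A"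
  shows "((\<lambda>k. \<Sum>i\<in>F. f i k) has_sum (\<Sum>i\<in>F. S i)) A"
  using assms by (induction F rule: finite_induct) (auto intro!: has_sum_add)

lemma summable_on_finite_sum:
  fixes f :: "'i \<Rightarrow> 'k \<Rightarrow> 'b::topological_comm_monoid_add"
  assumes "finite F" "\<And>i. i \<in> F \<Longrightarrow> f i summable_on A"
  shows "(\<lambda>k. \<Sum>i\<in>F. f i k) summable_on A"
  using assms by (induction F rule: finite_induct) (auto intro!: summable_on_add)

lemma infsum_finite_sum:
  fixes f :: "'i \<Rightarrow> 'k \<Rightarrow> 'b::{topological_comm_monoid_add, t2_space}"
  assumes "finite F" "\<And>i. i \<in> F \<Longrightarrow> f i summable_on A"
  shows "(\<Sum>\<^sub>\<infinity>k\<in>A. \<Sum>i\<in>F. f i k) = (\<Sum>i\<in>F. infsum (f i) A)"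
  using assms by (intro infsumI has_sum_finite_sum has_sum_infsum) auto

section \<open>The worst-case error as a sum over the dual lattice\<close>

text \<open>
  Up to a sign, the quadrature error of a lattice rule is the functional that adds up the Fourier
  coefficients over a set \<open>A\<close> of frequencies. By Cauchy-Schwarz for the weighted inner product its
  norm is the square root of the total weight of \<open>A\<close>.
\<close>

lemma (in fourier_rkhs) SUP_coeff_sum:
  assumes A: "A \<subseteq> I" "A \<noteq> {}"
  shows "(SUP f\<in>{f \<in> syn ` W. ip_norm ip f \<le> 1}. cmod (\<Sum>\<^sub>\<infinity>k\<in>A. fc f k)) = sqrt (\<Sum>\<^sub>\<infinity>k\<in>A. rr k)"
proof (rule cSup_eq_maximum)
  define R where "R = (\<Sum>\<^sub>\<infinity>k\<in>A. rr k)"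
  have sA: "rr summable_on A" using rr_sum A(1) by (rule summable_on_subset_banach)
  obtain k0 where k0: "k0 \<in> A" using A(2) by blast
  have "(\<Sum>k\<in>{k0}. rr k) \<le> R"
    unfolding R_def using k0 A sA rr_pos by (intro finite_sum_le_infsum) (auto intro: less_imp_le)
  then have R: "0 < R" using k0 A rr_pos[of k0] by auto
  have sR: "sqrt R * sqrt R = R" "0 < sqrt R" using R by auto
  show "sqrt (\<Sum>\<^sub>\<infinity>k\<in>A. rr k) \<in> (\<lambda>f. cmod (\<Sum>\<^sub>\<infinity>k\<in>A. fc f k)) ` {f \<in> syn ` W. ip_norm ip f \<le> 1}"
  proof
    \<comment> \<open>The normalised Riesz representer of the functional attains the supremum.\<close>
    define a where "a = (\<lambda>k. if k \<in> A then complex_of_real (rr k / sqrt R) else 0)"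
    have sq: "(cmod (a k))\<^sup>2 * inverse (rr k) = (if k \<in> A then rr k / R else 0)" if "k \<in> I" for k
      using rr_pos[OF that] R by (auto simp: a_def norm_divide power2_eq_square field_simps)
    have "(\<lambda>k. if k \<in> A then rr k / R else 0) summable_on I \<longleftrightarrow> (\<lambda>k. rr k * inverse R) summable_on A"
      using A by (intro summable_on_cong_neutral) (auto simp: divide_inverse)
    then have aW: "a \<in> W"
      unfolding W_def mem_Collect_eq using sA summable_on_cong[of I, OF sq]
      by (auto intro: summable_on_cmult_left)
    have "Q a = (\<Sum>\<^sub>\<infinity>k\<in>I. if k \<in> A then rr k / R else 0)"
      unfolding Q_def by (intro infsum_cong sq)
    also have "\<dots> = (\<Sum>\<^sub>\<infinity>k\<in>A. rr k * inverse R)"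
      using A by (intro infsum_cong_neutral) (auto simp: divide_inverse)
    also have "\<dots> = R * inverse R" unfolding R_def by (rule infsum_cmult_left')
    finally have "ip_norm ip (syn a) \<le> 1" using R by (simp add: norm_syn[OF aW])
    with aW show "syn a \<in> {f \<in> syn ` W. ip_norm ip f \<le> 1}" by simp
    have "(\<Sum>\<^sub>\<infinity>k\<in>A. fc (syn a) k) = (\<Sum>\<^sub>\<infinity>k\<in>A. complex_of_real (rr k) * of_real (inverse (sqrt R)))"
      using A by (intro infsum_cong, subst fc_synW[OF aW]) (auto simp: a_def divide_inverse)
    also have "\<dots> = (\<Sum>\<^sub>\<infinity>k\<in>A. complex_of_real (rr k)) * of_real (inverse (sqrt R))"
      by (rule infsum_cmult_left')
    also have "(\<Sum>\<^sub>\<infinity>k\<in>A. complex_of_real (rr k)) = of_real R"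
      unfolding R_def by (intro infsumI has_sum_of_real has_sum_infsum sA)
    finally have "cmod (\<Sum>\<^sub>\<infinity>k\<in>A. fc (syn a) k) = R * inverse (sqrt R)"
      using R by (simp add: norm_mult norm_inverse)
    also have "\<dots> = sqrt R" using sR by (simp add: field_simps)
    finally show "sqrt (\<Sum>\<^sub>\<infinity>k\<in>A. rr k) = cmod (\<Sum>\<^sub>\<infinity>k\<in>A. fc (syn a) k)" by (simp add: R_def)
  qed
  fix y assume "y \<in> (\<lambda>f. cmod (\<Sum>\<^sub>\<infinity>k\<in>A. fc f k)) ` {f \<in> syn ` W. ip_norm ip f \<le> 1}"
  then obtain a where a: "a \<in> W" "ip_norm ip (syn a) \<le> 1" and y: "y = cmod (\<Sum>\<^sub>\<infinity>k\<in>A. fc (syn a) k)"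
    by auto
  have Q1: "Q a \<le> 1" using a by (simp add: norm_syn)
  have sa: "(\<lambda>k. cmod (a k)) summable_on A"
    using W_abs[OF a(1)] A(1) by (rule summable_on_subset_banach)
  have sQ: "(\<lambda>k. (cmod (a k))\<^sup>2 * inverse (rr k)) summable_on I" using a by (simp add: W_def)
  then have sQA: "(\<lambda>k. (cmod (a k))\<^sup>2 * inverse (rr k)) summable_on A" using A(1) by (rule summable_on_subset_banach)
  have "(\<Sum>\<^sub>\<infinity>k\<in>A. fc (syn a) k) = (\<Sum>\<^sub>\<infinity>k\<in>A. a k)"
    using A by (intro infsum_cong fc_synW a) auto
  then have "y \<le> (\<Sum>\<^sub>\<infinity>k\<in>A. cmod (a k))" using y norm_infsum_bound[OF sa] by simp
  \<comment> \<open>Cauchy-Schwarz in the form of a termwise arithmetic-geometric mean inequality: with \<open>sqrt R\<close> as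
      the balancing factor, either half contributes at most \<open>sqrt R / 2\<close> after summation.\<close>
  also have "\<dots> \<le> (\<Sum>\<^sub>\<infinity>k\<in>A. sqrt R / 2 * ((cmod (a k))\<^sup>2 * inverse (rr k)) + inverse (2 * sqrt R) * rr k)"
  proof (rule infsum_mono[OF sa])
    show "(\<lambda>k. sqrt R / 2 * ((cmod (a k))\<^sup>2 * inverse (rr k)) + inverse (2 * sqrt R) * rr k) summable_on A"
      by (intro summable_on_add summable_on_cmult_right sQA sA)
    fix k assume "k \<in> A"
    then have r: "0 < rr k" using A rr_pos by auto
    have "0 \<le> (sqrt R * cmod (a k) - rr k)\<^sup>2 / (2 * sqrt R * rr k)" using r sR by simp
    also have "\<dots> = (sqrt R * sqrt R * (cmod (a k))\<^sup>2 - 2 * sqrt R * cmod (a k) * rr k + rr k * rr k) / (2 * sqrt R * rr k)"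
      by (simp add: power2_eq_square algebra_simps)
    also have "\<dots> = sqrt R / 2 * ((cmod (a k))\<^sup>2 * inverse (rr k)) + inverse (2 * sqrt R) * rr k - cmod (a k)"
      using r sR(2) by (simp add: divide_simps del: real_sqrt_mult_self)
    finally show "cmod (a k) \<le> sqrt R / 2 * ((cmod (a k))\<^sup>2 * inverse (rr k)) + inverse (2 * sqrt R) * rr k" by simp
  qed
  also have "\<dots> = sqrt R / 2 * (\<Sum>\<^sub>\<infinity>k\<in>A. (cmod (a k))\<^sup>2 * inverse (rr k)) + inverse (2 * sqrt R) * R"
    by (simp only: infsum_add[OF summable_on_cmult_right[OF sQA] summable_on_cmult_right[OF sA]] infsum_cmult_right' R_def)
  also have "(\<Sum>\<^sub>\<infinity>k\<in>A. (cmod (a k))\<^sup>2 * inverse (rr k)) \<le> Q a"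
    unfolding Q_def using A term_nonneg by (intro infsum_mono_neutral sQ sQA) auto
  also have "\<dots> \<le> 1" by (rule Q1)
  also have "sqrt R / 2 * 1 + inverse (2 * sqrt R) * R = sqrt R"
  proof -
    have "inverse (2 * sqrt R) * R = sqrt R / 2" using sR by (simp add: field_simps)
    then show ?thesis by simp
  qed
  finally show "y \<le> sqrt (\<Sum>\<^sub>\<infinity>k\<in>A. rr k)" using sR by (simp add: R_def)
qed

definition dual_lattice :: "nat \<Rightarrow> nat \<Rightarrow> (nat \<Rightarrow> nat) \<Rightarrow> (nat \<Rightarrow> int) set" where
  "dual_lattice d N g = {k \<in> multi_indices d. int N dvd (\<Sum>j=1..d. k j * int (g j))}"

abbreviation zero_index :: "nat \<Rightarrow> nat \<Rightarrow> int" where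
  "zero_index d \<equiv> (\<lambda>j\<in>{1..d}. 0)"

definition dual_lattice_sum ::
  "real \<Rightarrow> real \<Rightarrow> (nat \<Rightarrow> real) \<Rightarrow> nat \<Rightarrow> nat \<Rightarrow> (nat \<Rightarrow> nat) \<Rightarrow> real" where
  "dual_lattice_sum \<mu> \<kappa> \<gamma> N d g =
     (\<Sum>\<^sub>\<infinity>k\<in>dual_lattice d N g - {zero_index d}. r_weight \<mu> \<kappa> \<gamma> d k)"

text \<open>
  The points of the lattice rule form a cyclic group of order \<open>N\<close>, on which the exponential of
  frequency \<open>k\<close> is a character. It is trivial exactly for \<open>k\<close> in the dual lattice.
\<close>

lemma lattice_character_sum:
  assumes "N > 0"
  shows "(\<Sum>n<N. cis (2 * pi * index_dot d k (lattice_point d N g n)))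
    = (if int N dvd (\<Sum>j=1..d. k j * int (g j)) then of_nat N else 0)"
proof -
  define m where "m = (\<Sum>j=1..d. k j * int (g j))"
  define z where "z = cis (2 * pi * (of_int m / real N))"
  have "cis (2 * pi * index_dot d k (lattice_point d N g n)) = z ^ n" for n
  proof -
    \<comment> \<open>Fractional parts change the exponent by an integer only.\<close>
    define q where "q = (\<Sum>j=1..d. k j * \<lfloor>real n * real (g j) / real N\<rfloor>)"
    have "index_dot d k (lattice_point d N g n) = real n * (of_int m / real N) - of_int q"
      by (simp add: index_dot_def lattice_point_def frac_def m_def q_def right_diff_distrib
          sum_subtractf sum_divide_distrib sum_distrib_left mult_ac)
    from arg_cong[OF this, of "\<lambda>x. 2 * pi * x"]
    have eq: "2 * pi * index_dot d k (lattice_point d N g n)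
        = real n * (2 * pi * (of_int m / real N)) + 2 * pi * of_int (- q)"
      by (simp add: right_diff_distrib mult_ac)
    have "cis (2 * pi * index_dot d k (lattice_point d N g n))
        = cis (real n * (2 * pi * (of_int m / real N))) * cis (2 * pi * of_int (- q))"
      unfolding eq by (rule cis_mult[symmetric])
    also have "\<dots> = z ^ n" unfolding z_def by (simp only: cis_multiple_2pi Ints_of_int Complex.DeMoivre)  simp
    finally show ?thesis .
  qed
  moreover have "(\<Sum>n<N. z ^ n) = (if int N dvd m then of_nat N else 0)"
  proof (cases "int N dvd m")
    case True
    then obtain l where "m = int N * l" by blast
    then have "z = 1" using assms unfolding z_def by (simp add: cis_multiple_2pi)
    then show ?thesis using True by simp
  next
    case False
    have "z \<noteq> 1"
    proof
      assume "z = 1"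
      then obtain l :: int where "2 * pi * (of_int m / real N) = 2 * pi * of_int l"
        unfolding z_def complex_eq_iff by (auto simp: cos_one_2pi_int mult_ac)
      then have "real_of_int m = of_int (l * int N)" using assms by (simp add: field_simps)
      then have "m = l * int N" by linarith
      then show False using False by simp
    qed
    moreover have "z ^ N = cis (2 * pi * of_int m)"
      unfolding z_def Complex.DeMoivre using assms by (simp add: field_simps)
    then have "z ^ N = 1" by (simp add: cis_multiple_2pi)
    ultimately have "(\<Sum>n<N. z ^ n) = 0" using geometric_sum[of z N] by simp
    then show ?thesis using False by simp
  qed
  ultimately show ?thesis by (simp add: m_def)
qed

lemma r_weight_pos:
  assumes "\<kappa> > 1" "\<And>j. j \<ge> 1 \<Longrightarrow> \<gamma> j > 0"
  shows "0 < r_weight \<mu> \<kappa> \<gamma> d k"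
  unfolding r_weight_def using assms by (intro prod_pos ballI r1_weight_pos) auto

lemma prod_summable_on_multi_indices:
  fixes f :: "nat \<Rightarrow> int \<Rightarrow> real"
  assumes "\<And>j m. j \<in> {1..d} \<Longrightarrow> 0 \<le> f j m" "\<And>j. j \<in> {1..d} \<Longrightarrow> f j summable_on UNIV"
  shows "(\<lambda>k. \<Prod>j=1..d. f j (k j)) summable_on multi_indices d"
proof -
  have "Infinite_Set_Sum.abs_summable_on (f j) UNIV" if "j \<in> {1..d}" for j
  proof -
    have "(\<lambda>k. norm (f j k)) summable_on UNIV"
      using assms that by simp
    then show ?thesis by (simp only: abs_summable_equivalent)
  qed
  then have "Infinite_Set_Sum.abs_summable_on (\<lambda>k. \<Prod>j\<in>{1..d}. f j (k j)) (multi_indices d)"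
    unfolding multi_indices_def by (intro abs_summable_on_prod_PiE) auto
  then have "(\<lambda>k. norm (\<Prod>j\<in>{1..d}. f j (k j))) summable_on multi_indices d"
    by (simp only: abs_summable_equivalent)
  then show ?thesis by (rule abs_summable_summable)
qed

lemma infsum_prod_multi_indices:
  fixes f :: "nat \<Rightarrow> int \<Rightarrow> real"
  assumes "\<And>j m. j \<in> {1..d} \<Longrightarrow> 0 \<le> f j m" "\<And>j. j \<in> {1..d} \<Longrightarrow> f j summable_on UNIV"
  shows "(\<Sum>\<^sub>\<infinity>k\<in>multi_indices d. \<Prod>j=1..d. f j (k j)) = (\<Prod>j=1..d. \<Sum>\<^sub>\<infinity>m\<in>UNIV. f j m)"
  unfolding multi_indices_def using assms by (intro infsum_prod_PiE_abs) auto

lemma r_weight_summable: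
  assumes "\<mu> > 1" "\<kappa> > 1" "\<And>j. j \<ge> 1 \<Longrightarrow> \<gamma> j > 0"
  shows "r_weight \<mu> \<kappa> \<gamma> d summable_on multi_indices d"
  unfolding r_weight_def using assms
  by (intro prod_summable_on_multi_indices r1_weight_summable less_imp_le[OF r1_weight_pos]) auto

text \<open>
  The lattice rule integrates every exponential outside the dual lattice exactly and gives 1 on the
  others, so its error on \<open>f\<close> is the sum of the Fourier coefficients of \<open>f\<close> over the non-zero
  points of the dual lattice.
\<close>

theorem lattice_error_squared:
  assumes \<mu>: "\<mu> > 1" and \<kappa>: "\<kappa> > 1" and d: "d \<ge> 1" and \<gamma>: "\<And>j. j \<ge> 1 \<Longrightarrow> \<gamma> j > 0" and N: "N > 0"
  shows "(lattice_error \<mu> \<kappa> \<gamma> N d g)\<^sup>2 = dual_lattice_sum \<mu> \<kappa> \<gamma> N d g"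
proof -
  interpret fourier_rkhs "unit_cube d" "multi_indices d" "r_weight \<mu> \<kappa> \<gamma> d" "\<lambda>k x. cis (2 * pi * index_dot d k x)" "fourier_coeff d"
    using assms fourier_coeff_syn r_weight_pos r_weight_summable by unfold_locales auto
  have ip: "ip = korobov_ip \<mu> \<kappa> \<gamma> d"
    by (simp add: fun_eq_iff ip_def S_def korobov_ip_def)
  have K: "K = korobov_kernel \<mu> \<kappa> \<gamma> d"
    by (simp add: fun_eq_iff K_def korobov_kernel_def dot_restrict cis_mult cis_cnj right_diff_distrib)
  have H: "korobov_space \<mu> \<kappa> \<gamma> d = syn ` W"
    unfolding korobov_space_def using rkhs_iff[unfolded ip K] by simp
  let ?L = "dual_lattice d N g" and ?z = "zero_index d"
  let ?A = "?L - {?z}"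
  have zL: "?z \<in> ?L" by (auto simp: dual_lattice_def multi_indices_def)
  have LI: "?L \<subseteq> multi_indices d" by (auto simp: dual_lattice_def)
  \<comment> \<open>A non-zero point of the dual lattice, needed because the supremum formula is for non-empty sets.\<close>
  have "(\<lambda>j\<in>{1..d}. int N) \<in> ?A"
  proof -
    have "(\<lambda>j\<in>{1..d}. int N) \<in> ?L"
      by (auto simp: dual_lattice_def multi_indices_def intro!: dvd_sum)
    moreover have "(\<lambda>j\<in>{1..d}. int N) 1 \<noteq> ?z 1" using d N by simp
    ultimately show ?thesis by (auto simp del: restrict_apply)
  qed
  then have A: "?A \<subseteq> multi_indices d" "?A \<noteq> {}" using LI by auto
  have err: "(\<integral>t. f t \<partial>cube_measure d) - (\<Sum>n<N. f (lattice_point d N g n)) / of_nat N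
      = - (\<Sum>\<^sub>\<infinity>k\<in>?A. fourier_coeff d f k)" if f: "f \<in> syn ` W" for f
  proof -
    obtain a where a: "a \<in> W" "f = syn a" using f by blast
    note sa = W_abs[OF a(1)]
    have sI: "a summable_on B" if "B \<subseteq> multi_indices d" for B
      using abs_summable_summable[OF sa] that by (rule summable_on_subset_banach)
    have "(\<integral>t. f t \<partial>cube_measure d) = fourier_coeff d f ?z"
      unfolding fourier_coeff_def by (intro Bochner_Integration.integral_cong) (auto simp: index_dot_def)
    also have "\<dots> = a ?z" unfolding a(2) using zL LI by (intro fc_synW a) auto
    finally have int: "(\<integral>t. f t \<partial>cube_measure d) = a ?z" .
    let ?E = "\<lambda>n k. cis (2 * pi * index_dot d k (lattice_point d N g n))"
    have pt: "lattice_point d N g n \<in> unit_cube d" for n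
      by (auto simp: lattice_point_def unit_cube_def less_imp_le[OF frac_lt_1])
    have "(\<Sum>n<N. f (lattice_point d N g n)) = (\<Sum>n<N. \<Sum>\<^sub>\<infinity>k\<in>multi_indices d. a k * ?E n k)"
      using pt by (simp add: a(2) syn_def)
    also have "\<dots> = (\<Sum>\<^sub>\<infinity>k\<in>multi_indices d. \<Sum>n<N. a k * ?E n k)"
      by (rule infsum_finite_sum[symmetric]) (simp_all add: syn_summable[OF sa])
    also have "\<dots> = (\<Sum>\<^sub>\<infinity>k\<in>?L. a k * of_nat N)"
      unfolding sum_distrib_left[symmetric] lattice_character_sum[OF N]
      by (intro infsum_cong_neutral) (auto simp: dual_lattice_def)
    also have "\<dots> = (\<Sum>\<^sub>\<infinity>k\<in>?L. a k) * of_nat N" by (rule infsum_cmult_left')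
    also have "(\<Sum>\<^sub>\<infinity>k\<in>?L. a k) = a ?z + (\<Sum>\<^sub>\<infinity>k\<in>?A. a k)"
    proof -
      have "?L = {?z} \<union> ?A" using zL by blast
      then have "(\<Sum>\<^sub>\<infinity>k\<in>?L. a k) = (\<Sum>\<^sub>\<infinity>k\<in>{?z} \<union> ?A. a k)" by simp
      also have "\<dots> = (\<Sum>\<^sub>\<infinity>k\<in>{?z}. a k) + (\<Sum>\<^sub>\<infinity>k\<in>?A. a k)"
        using A by (intro infsum_Un_disjoint sI) (auto simp: multi_indices_def)
      finally show ?thesis by simp
    qed
    also have "(\<Sum>\<^sub>\<infinity>k\<in>?A. a k) = (\<Sum>\<^sub>\<infinity>k\<in>?A. fourier_coeff d f k)"
      unfolding a(2) using A by (intro infsum_cong fc_synW[symmetric] a) auto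
    finally show ?thesis unfolding int using N by (simp add: field_simps del: restrict_apply)
  qed
  have "lattice_error \<mu> \<kappa> \<gamma> N d g = sqrt (\<Sum>\<^sub>\<infinity>k\<in>?A. r_weight \<mu> \<kappa> \<gamma> d k)"
    unfolding lattice_error_def worst_case_error_def H SUP_coeff_sum[OF A, symmetric] ip[symmetric]
    by (intro SUP_cong refl) (simp add: err)
  moreover have "0 \<le> (\<Sum>\<^sub>\<infinity>k\<in>?A. r_weight \<mu> \<kappa> \<gamma> d k)"
    using A rr_pos by (intro infsum_nonneg) (auto intro: less_imp_le)
  ultimately show ?thesis by (simp add: dual_lattice_sum_def)
qed

section \<open>The logarithmic gauge\<close>

text \<open>
  The maximum keeps the function increasing: \<open>x * (- ln x) powr a\<close> alone increases only while
  \<open>- ln x \<ge> a\<close>. Below \<open>exp (-p)\<close> the gauge is this function, above it is linear.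
\<close>

definition log_gauge :: "real \<Rightarrow> real \<Rightarrow> real \<Rightarrow> real" where
  "log_gauge p a x = x * max p (- ln x) powr a"

text \<open>
  When \<open>x\<close> decreases to \<open>exp (-t) * x\<close>, the maximum grows from some \<open>v \<ge> p \<ge> a\<close> to at most
  \<open>v + t\<close>, and \<open>((v + t) / v) powr a \<le> exp (a * t / v) \<le> exp t\<close>.
\<close>

lemma log_gauge_mono:
  assumes "0 < p" "0 \<le> a" "a \<le> p" "0 \<le> x" "x \<le> y"
  shows "log_gauge p a x \<le> log_gauge p a y"
proof (cases "x = 0")
  case True
  then show ?thesis using assms by (simp add: log_gauge_def)
next
  case False
  define u v where "u = max p (- ln x)" and "v = max p (- ln y)"
  have xy: "0 < x" "0 < y" using False assms by auto
  have l: "ln x \<le> ln y" using xy assms by simp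
  have uv: "v \<le> u" "u - v \<le> ln y - ln x" "p \<le> v" using l by (auto simp: u_def v_def)
  have pos: "0 < v" "0 < u" using uv assms by auto
  have "ln (u / v) \<le> u / v - 1" using pos by (intro ln_le_minus_one) auto
  then have "a * ln (u / v) \<le> a * (u / v - 1)" using assms by (intro mult_left_mono) auto
  also have "\<dots> \<le> v * (u / v - 1)" using assms uv pos by (intro mult_right_mono) (auto simp: field_simps)
  also have "\<dots> = u - v" using pos by (simp add: field_simps)
  finally have "a * ln u - a * ln v \<le> ln y - ln x" using uv pos by (simp add: ln_div algebra_simps)
  then have "exp (ln x + a * ln u) \<le> exp (ln y + a * ln v)" by simp
  then show ?thesis using xy pos by (simp add: log_gauge_def u_def[symmetric] v_def[symmetric] exp_add powr_def)
qed

text \<open>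
  Countable subadditivity, combined with an upper bound on the terms: the factor
  \<open>max p (- ln x) powr a\<close> does not increase with \<open>x\<close>, so at the whole sum it is at most its value at each term.
\<close>

lemma log_gauge_infsum_le:
  assumes a: "0 \<le> a" and p: "0 \<le> p" and s: "f summable_on A" and pos: "\<And>k. k \<in> A \<Longrightarrow> 0 < f k"
    and h: "h summable_on A" and le: "\<And>k. k \<in> A \<Longrightarrow> log_gauge p a (f k) \<le> h k"
  shows "log_gauge p a (infsum f A) \<le> infsum h A"
proof -
  let ?S = "infsum f A"
  have "log_gauge p a ?S = (\<Sum>\<^sub>\<infinity>k\<in>A. f k * max p (- ln ?S) powr a)"
    unfolding log_gauge_def by (rule infsum_cmult_left'[symmetric])
  also have "\<dots> \<le> infsum h A"
  proof (rule infsum_mono[OF summable_on_cmult_left[OF s] h])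
    fix k assume k: "k \<in> A"
    have "(\<Sum>k\<in>{k}. f k) \<le> ?S"
      using k pos s by (intro finite_sum_le_infsum) (auto intro: less_imp_le)
    then have "f k \<le> ?S" by simp
    then have "ln (f k) \<le> ln ?S" using pos[OF k] by simp
    then have "f k * max p (- ln ?S) powr a \<le> log_gauge p a (f k)"
      unfolding log_gauge_def using a p pos[OF k] by (intro mult_left_mono powr_mono2) auto
    then show "f k * max p (- ln ?S) powr a \<le> h k" using le[OF k] by linarith
  qed
  finally show ?thesis .
qed

lemma log_gauge_add_le:
  assumes "0 \<le> a" "0 \<le> p" "0 \<le> x" "0 \<le> y"
  shows "log_gauge p a (x + y) \<le> log_gauge p a x + log_gauge p a y"
proof (cases "x = 0 \<or> y = 0")
  case True
  then show ?thesis using assms by (auto simp: log_gauge_def)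
next
  case False
  then have "ln x \<le> ln (x + y)" "ln y \<le> ln (x + y)" using assms by auto
  then have "x * max p (- ln (x + y)) powr a \<le> log_gauge p a x"
    "y * max p (- ln (x + y)) powr a \<le> log_gauge p a y"
    unfolding log_gauge_def using assms by (intro mult_left_mono powr_mono2; auto)+
  then show ?thesis by (simp add: log_gauge_def distrib_right)
qed

text \<open>
  The gauge can be inverted without loss because \<open>p \<ge> 1\<close> forces \<open>x \<le> t\<close>, which allows \<open>- ln x\<close> to be
  replaced by the smaller \<open>- ln t\<close>.
\<close>

lemma le_of_log_gauge_le:
  assumes a: "0 \<le> a" and p: "1 \<le> p" and x: "0 \<le> x" and t: "0 < t" "t < 1" and le: "log_gauge p a x \<le> t"
  shows "x \<le> t / ln (1 / t) powr a"
proof (cases "x = 0")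
  case True
  then show ?thesis using t by simp
next
  case False
  then have x0: "0 < x" using x by simp
  have lt: "0 < ln (1 / t)" using t by simp
  have "1 powr a \<le> max p (- ln x) powr a" using a p by (intro powr_mono2) auto
  then have "x * 1 \<le> log_gauge p a x" unfolding log_gauge_def using x by (intro mult_left_mono) auto
  then have "x \<le> t" using le by simp
  then have "ln x \<le> ln t" using x0 by simp
  then have "ln (1 / t) \<le> max p (- ln x)" using t by (simp add: ln_div)
  then have "ln (1 / t) powr a \<le> max p (- ln x) powr a" using a lt by (intro powr_mono2) auto
  then have "x * ln (1 / t) powr a \<le> log_gauge p a x" unfolding log_gauge_def using x by (intro mult_left_mono) auto
  also have "\<dots> \<le> t" by (rule le)
  finally show ?thesis using lt by (simp add: field_simps)
qed

section \<open>The gauge of the weights\<close>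

text \<open>
  Two numbers that are at least 2 satisfy \<open>u + v \<le> u * v\<close>. The maximum with 1 makes the value 0,
  which belongs to a coordinate with frequency 0, neutral for the product.
\<close>

lemma max_one_sum_le_prod:
  fixes u :: "'a \<Rightarrow> real"
  assumes "finite J" "\<And>j. j \<in> J \<Longrightarrow> u j = 0 \<or> 2 \<le> u j"
  shows "max 1 (\<Sum>j\<in>J. u j) \<le> (\<Prod>j\<in>J. max 1 (u j))"
proof -
  have "((\<Sum>j\<in>J. u j) = 0 \<or> 2 \<le> (\<Sum>j\<in>J. u j)) \<and> max 1 (\<Sum>j\<in>J. u j) \<le> (\<Prod>j\<in>J. max 1 (u j))"
    using assms
  proof (induction J rule: finite_induct)
    case (insert i J)
    define U where "U = (\<Sum>j\<in>J. u j)"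
    have IH: "U = 0 \<or> 2 \<le> U" "max 1 U \<le> (\<Prod>j\<in>J. max 1 (u j))" using insert by (auto simp: U_def)
    have ui: "u i = 0 \<or> 2 \<le> u i" using insert by auto
    have "max 1 (u i + U) \<le> max 1 (u i) * max 1 U"
    proof (cases "u i = 0 \<or> U = 0")
      case False
      then have *: "2 \<le> u i" "2 \<le> U" using ui IH by auto
      have "0 \<le> (u i - 2) * (U - 2)" "u i * 2 \<le> u i * U" "2 * U \<le> u i * U"
        using * by (auto intro!: mult_nonneg_nonneg mult_left_mono mult_right_mono)
      then have "u i + U \<le> u i * U" using * by linarith
      then show ?thesis using * by auto
    qed auto
    also have "\<dots> \<le> max 1 (u i) * (\<Prod>j\<in>J. max 1 (u j))" using IH by (intro mult_left_mono) auto
    finally show ?case using insert.hyps IH ui by (auto simp: U_def[symmetric])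
  qed simp
  then show ?thesis by simp
qed

text \<open>
  With these weights and the exponent \<open>\<mu> - a\<close>, the log-Korobov weights of the non-zero frequencies
  dominate the gauge of the original ones.
\<close>

definition dominating_weights :: "real \<Rightarrow> real \<Rightarrow> (nat \<Rightarrow> real) \<Rightarrow> nat \<Rightarrow> real" where
  "dominating_weights \<mu> a \<gamma> j = \<gamma> j * (2 + \<mu>) powr a * max 1 (ln (inverse (\<gamma> j))) powr a"

text \<open>
  The condition \<open>\<kappa> \<ge> exp (exp 2 * \<gamma> powr (1 / \<mu>))\<close> says that \<open>ln \<kappa> powr \<mu> \<ge> exp (2 * \<mu>) * \<gamma>\<close>, so the
  factor \<open>ln (\<kappa> * |m|) powr (- \<mu>)\<close> compensates a large \<open>\<gamma>\<close>. In the other direction, each of the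
  three parts \<open>- ln \<gamma>\<close>, \<open>ln |m|\<close> and \<open>\<mu> * ln (ln (\<kappa> * |m|))\<close> of the negated logarithm is at most a multiple of
  \<open>max 1 (ln (inverse \<gamma>)) * ln (\<kappa> * |m|)\<close>; its power \<open>a\<close> therefore costs a constant, a power of the
  first factor and a lowering of \<open>\<mu>\<close> by \<open>a\<close>.
\<close>

lemma r1_weight_log_bounds:
  assumes \<mu>: "\<mu> > 1" and a: "0 \<le> a" and g: "0 < \<gamma>" and \<kappa>: "\<kappa> \<ge> exp (exp 2)" "\<kappa> \<ge> exp (exp 2 * \<gamma> powr (1 / \<mu>))"
    and m: "m \<noteq> 0"
  shows "2 * \<mu> \<le> - ln (r1_weight \<mu> \<kappa> \<gamma> m)"
    and "r1_weight \<mu> \<kappa> \<gamma> m * max 1 (- ln (r1_weight \<mu> \<kappa> \<gamma> m)) powr a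
      \<le> r1_weight (\<mu> - a) \<kappa> (\<gamma> * (2 + \<mu>) powr a * max 1 (ln (inverse \<gamma>)) powr a) m"
proof -
  define x where "x = \<bar>real_of_int m\<bar>"
  define L where "L = ln (\<kappa> * x)"
  define M where "M = max 1 (ln (inverse \<gamma>))"
  define u where "u = - ln (r1_weight \<mu> \<kappa> \<gamma> m)"
  have x: "1 \<le> x" using m unfolding x_def by linarith
  have k0: "1 < \<kappa>" using \<kappa>(1) less_le_trans[of 1 "exp (exp 2)" \<kappa>] by simp
  have kx: "\<kappa> * 1 \<le> \<kappa> * x" using x k0 by (intro mult_left_mono) auto
  have Lk: "ln \<kappa> \<le> L" unfolding L_def using kx k0 by (subst ln_le_cancel_iff) auto
  have k1: "exp 2 \<le> ln \<kappa>" "exp 2 * \<gamma> powr (1 / \<mu>) \<le> ln \<kappa>" using \<kappa> k0 by (simp_all add: ln_ge_iff)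
  have L1: "1 \<le> L" using Lk k1(1) exp_ge_add_one_self[of 2] by linarith
  have "ln (exp 2 * \<gamma> powr (1 / \<mu>)) \<le> ln L" using Lk k1 g L1 by (subst ln_le_cancel_iff) auto
  then have "2 + ln \<gamma> / \<mu> \<le> ln L" using g by (simp add: ln_mult ln_powr)
  then have "\<mu> * (2 + ln \<gamma> / \<mu>) \<le> \<mu> * ln L" using \<mu> by (intro mult_left_mono) auto
  then have lnL: "2 * \<mu> + ln \<gamma> \<le> \<mu> * ln L" using \<mu> by (simp add: algebra_simps)
  have r: "r1_weight \<mu> \<kappa> \<gamma> m = \<gamma> * inverse x * L powr (-\<mu>)"
    using m by (simp add: r1_weight_def x_def L_def)
  have u: "u = - ln \<gamma> + ln x + \<mu> * ln L"
    unfolding u_def r using g x L1 by (simp add: ln_mult ln_inverse ln_powr)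
  have lnx: "0 \<le> ln x" using x by simp
  show "2 * \<mu> \<le> - ln (r1_weight \<mu> \<kappa> \<gamma> m)" using u lnL lnx by (simp add: u_def)
  have M1: "1 \<le> M" "- ln \<gamma> \<le> M" using g by (auto simp: M_def ln_inverse)
  have ML1: "M \<le> M * L" "L \<le> M * L" "1 \<le> M * L" using M1 L1 mult_mono[of 1 M 1 L] by auto
  have "ln x \<le> L" unfolding L_def using x k0 mult_right_mono[of 1 \<kappa> x] by (subst ln_le_cancel_iff) auto
  moreover have "ln L \<le> M * L" using L1 ML1(2) ln_le_minus_one[of L] by linarith
  then have "\<mu> * ln L \<le> \<mu> * (M * L)" using \<mu> by simp
  ultimately have "u \<le> (2 + \<mu>) * (M * L)" unfolding u distrib_right using ML1 M1 by linarith
  moreover have "1 \<le> (2 + \<mu>) * (M * L)" using ML1 \<mu> mult_mono[of 1 "2 + \<mu>" 1 "M * L"] by auto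
  ultimately have "max 1 u powr a \<le> ((2 + \<mu>) * (M * L)) powr a" using a by (intro powr_mono2) auto
  also have "\<dots> = (2 + \<mu>) powr a * M powr a * L powr a" using \<mu> M1 L1 by (simp add: powr_mult)
  finally have "r1_weight \<mu> \<kappa> \<gamma> m * max 1 u powr a \<le> (\<gamma> * inverse x * L powr (-\<mu>)) * ((2 + \<mu>) powr a * M powr a * L powr a)"
    unfolding r using g x by (intro mult_left_mono) auto
  also have "L powr (- \<mu>) = L powr (- (\<mu> - a)) * inverse (L powr a)"
    by (simp add: powr_minus[symmetric] powr_add[symmetric])
  also have "(\<gamma> * inverse x * (L powr (- (\<mu> - a)) * inverse (L powr a))) * ((2 + \<mu>) powr a * M powr a * L powr a)
      = \<gamma> * (2 + \<mu>) powr a * M powr a * inverse x * L powr (- (\<mu> - a))"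
    using L1 by simp
  finally show "r1_weight \<mu> \<kappa> \<gamma> m * max 1 (- ln (r1_weight \<mu> \<kappa> \<gamma> m)) powr a
      \<le> r1_weight (\<mu> - a) \<kappa> (\<gamma> * (2 + \<mu>) powr a * max 1 (ln (inverse \<gamma>)) powr a) m"
    unfolding u_def[symmetric] M_def[symmetric] using m
    by (simp add: r1_weight_def[of "\<mu> - a"] x_def[symmetric] L_def[symmetric])
qed

text \<open>
  A non-zero frequency is required: for \<open>k = 0\<close> the weight is 1 and its gauge \<open>(2 * \<mu>) powr a\<close> may
  exceed 1. A single non-zero coordinate already makes the logarithm at least \<open>2 * \<mu>\<close>, so that the
  maximum in the gauge may be taken with 1 instead, and the gauge becomes submultiplicative.
\<close>

lemma log_gauge_r_weight_le:
  assumes \<mu>: "\<mu> > 1" and a: "0 \<le> a" and g: "\<And>j. j \<ge> 1 \<Longrightarrow> 0 < \<gamma> j"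
    and \<kappa>: "\<kappa> \<ge> exp (exp 2)" "\<And>j. j \<ge> 1 \<Longrightarrow> \<kappa> \<ge> exp (exp 2 * \<gamma> j powr (1 / \<mu>))"
    and k: "i \<in> {1..d}" "k i \<noteq> 0"
  shows "log_gauge (2 * \<mu>) a (r_weight \<mu> \<kappa> \<gamma> d k) \<le> r_weight (\<mu> - a) \<kappa> (dominating_weights \<mu> a \<gamma>) d k"
proof -
  define r where "r = (\<lambda>j. r1_weight \<mu> \<kappa> (\<gamma> j) (k j))"
  define u where "u = (\<lambda>j. - ln (r j))"
  have k0: "1 < \<kappa>" using \<kappa>(1) less_le_trans[of 1 "exp (exp 2)" \<kappa>] by simp
  have rp: "0 < r j" if "j \<in> {1..d}" for j using that g k0 by (auto simp: r_def intro!: r1_weight_pos)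
  have u0: "u j = 0" if "k j = 0" for j using that by (simp add: u_def r_def r1_weight_def)
  have u2: "2 * \<mu> \<le> u j" if "j \<in> {1..d}" "k j \<noteq> 0" for j
    unfolding u_def r_def using that by (intro r1_weight_log_bounds(1)[OF \<mu> a g \<kappa>]) auto
  have un: "0 \<le> u j" if "j \<in> {1..d}" for j using u0[of j] u2[OF that] \<mu> by (cases "k j = 0") auto
  have lnr: "- ln (r_weight \<mu> \<kappa> \<gamma> d k) = (\<Sum>j=1..d. u j)"
    unfolding r_weight_def r_def[symmetric] u_def using rp[THEN less_imp_neq] by (subst ln_prod) (auto simp: sum_negf)
  have "2 * \<mu> \<le> u i" by (rule u2[OF k])
  also have "\<dots> \<le> (\<Sum>j=1..d. u j)" using k un by (intro member_le_sum) auto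
  finally have "max (2 * \<mu>) (- ln (r_weight \<mu> \<kappa> \<gamma> d k)) = max 1 (\<Sum>j=1..d. u j)" using \<mu> lnr by auto
  also have "\<dots> \<le> (\<Prod>j=1..d. max 1 (u j))"
  proof (rule max_one_sum_le_prod)
    show "u j = 0 \<or> 2 \<le> u j" if "j \<in> {1..d}" for j
      using u0[of j] u2[OF that] \<mu> by (cases "k j = 0") auto
  qed simp
  finally have "max (2 * \<mu>) (- ln (r_weight \<mu> \<kappa> \<gamma> d k)) powr a \<le> (\<Prod>j=1..d. max 1 (u j)) powr a"
    using a \<mu> by (intro powr_mono2) auto
  then have "log_gauge (2 * \<mu>) a (r_weight \<mu> \<kappa> \<gamma> d k) \<le> (\<Prod>j=1..d. r j) * (\<Prod>j=1..d. max 1 (u j)) powr a"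
    unfolding log_gauge_def r_weight_def r_def[symmetric]
    by (intro mult_left_mono prod_nonneg ballI less_imp_le[OF rp])
  also have "\<dots> = (\<Prod>j=1..d. r j * max 1 (u j) powr a)"
    by (simp add: prod.distrib prod_powr_distrib)
  also have "\<dots> \<le> r_weight (\<mu> - a) \<kappa> (dominating_weights \<mu> a \<gamma>) d k"
    unfolding r_weight_def
  proof (rule prod_mono, intro conjI)
    fix j assume j: "j \<in> {1..d}"
    show "0 \<le> r j * max 1 (u j) powr a" using rp[OF j] by simp
    show "r j * max 1 (u j) powr a \<le> r1_weight (\<mu> - a) \<kappa> (dominating_weights \<mu> a \<gamma> j) (k j)"
    proof (cases "k j = 0")
      case True
      then show ?thesis using u0[of j] by (simp add: r_def r1_weight_def)
    next
      case False
      then show ?thesis unfolding u_def r_def dominating_weights_def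
        using j by (intro r1_weight_log_bounds(2)[OF \<mu> a g \<kappa>]) auto
    qed
  qed
  finally show ?thesis .
qed

section \<open>The frequencies added by a new component\<close>

lemma r1_weight_multiple_le:
  assumes "\<kappa> > 1" "\<gamma> > 0" "N > 0" "m \<noteq> 0" "0 \<le> \<nu>"
  shows "r1_weight \<nu> \<kappa> \<gamma> (int N * m) \<le> r1_weight \<nu> \<kappa> \<gamma> m / real N"
proof -
  define x where "x = \<bar>real_of_int m\<bar>"
  have x: "1 \<le> x" using assms unfolding x_def by linarith
  have N: "1 \<le> real N" using assms by simp
  have 1: "1 < \<kappa> * x" using mult_less_le_imp_less[of 1 \<kappa> 1 x] assms x by simp
  have 2: "\<kappa> * x \<le> \<kappa> * (real N * x)" using assms N x by (intro mult_left_mono) auto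
  have 3: "ln (\<kappa> * x) \<le> ln (\<kappa> * (real N * x))" using 1 2 by (subst ln_le_cancel_iff) auto
  have "ln (\<kappa> * (real N * x)) powr (-\<nu>) \<le> ln (\<kappa> * x) powr (-\<nu>)"
    using 1 assms(5) by (intro powr_mono2'[OF _ _ 3]) auto
  then have "\<gamma> * inverse (real N * x) * ln (\<kappa> * (real N * x)) powr (-\<nu>) \<le> \<gamma> * inverse (real N * x) * ln (\<kappa> * x) powr (-\<nu>)"
    using assms x by (intro mult_left_mono) auto
  then show ?thesis using assms by (simp add: r1_weight_def abs_mult x_def[symmetric] field_simps)
qed

lemma bij_betw_zero_extension:
  "bij_betw (\<lambda>k. k(Suc d := 0)) (dual_lattice d N g - {zero_index d})
     {k \<in> dual_lattice (Suc d) N g - {zero_index (Suc d)}. k (Suc d) = 0}"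
proof (rule bij_betwI[where g = "\<lambda>k. k(Suc d := undefined)"])
  have upd: "(\<lambda>j\<in>{1..Suc d}. 0)(Suc d := undefined) = zero_index d" by (auto simp: fun_eq_iff)
  show "(\<lambda>k. k(Suc d := 0)) \<in> dual_lattice d N g - {zero_index d} \<rightarrow>
      {k \<in> dual_lattice (Suc d) N g - {zero_index (Suc d)}. k (Suc d) = 0}"
  proof
    fix k assume k: "k \<in> dual_lattice d N g - {zero_index d}"
    then have "k \<in> multi_indices d" by (simp add: dual_lattice_def)
    then have u: "k (Suc d) = undefined" unfolding multi_indices_def by (rule PiE_arb) simp
    have "k(Suc d := 0) \<noteq> zero_index (Suc d)"
    proof
      assume "k(Suc d := 0) = zero_index (Suc d)"
      then have "(k(Suc d := 0))(Suc d := undefined) = (zero_index (Suc d))(Suc d := undefined)" by simp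
      then have "k = zero_index d" unfolding upd using u by (metis fun_upd_triv fun_upd_upd)
      with k show False by simp
    qed
    moreover have "k(Suc d := 0) \<in> multi_indices (Suc d)"
      using k by (auto simp: dual_lattice_def multi_indices_def PiE_def extensional_def)
    ultimately show "k(Suc d := 0) \<in> {k \<in> dual_lattice (Suc d) N g - {zero_index (Suc d)}. k (Suc d) = 0}"
      using k by (auto simp: dual_lattice_def)
  qed
  show "(\<lambda>k. k(Suc d := undefined)) \<in> {k \<in> dual_lattice (Suc d) N g - {zero_index (Suc d)}. k (Suc d) = 0}
      \<rightarrow> dual_lattice d N g - {zero_index d}"
  proof
    fix k assume k: "k \<in> {k \<in> dual_lattice (Suc d) N g - {zero_index (Suc d)}. k (Suc d) = 0}"
    have "k(Suc d := undefined) \<noteq> zero_index d"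
    proof
      assume "k(Suc d := undefined) = zero_index d"
      then have "(k(Suc d := undefined))(Suc d := 0) = (zero_index d)(Suc d := 0)" by simp
      moreover have "(zero_index d)(Suc d := 0) = zero_index (Suc d)" by (auto simp: fun_eq_iff)
      ultimately have "k = zero_index (Suc d)" using k by (metis (mono_tags, lifting) fun_upd_triv fun_upd_upd mem_Collect_eq)
      with k show False by simp
    qed
    moreover have "k(Suc d := undefined) \<in> multi_indices d"
      using k by (auto simp: dual_lattice_def multi_indices_def PiE_def extensional_def)
    ultimately show "k(Suc d := undefined) \<in> dual_lattice d N g - {zero_index d}"
      using k by (auto simp: dual_lattice_def)
  qed
  show "(k(Suc d := 0))(Suc d := undefined) = k" if "k \<in> dual_lattice d N g - {zero_index d}" for k
  proof -
    have "k (Suc d) = undefined" using that by (auto simp: dual_lattice_def multi_indices_def PiE_def extensional_def)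
    then show ?thesis by auto
  qed
  show "(k(Suc d := undefined))(Suc d := 0) = k"
    if "k \<in> {k \<in> dual_lattice (Suc d) N g - {zero_index (Suc d)}. k (Suc d) = 0}" for k
    using that by auto
qed

text \<open>
  Dual lattice points whose last coordinate is 0 are the dual lattice points of the previous
  dimension, with the same weight. Only the second sum depends on the new component.
\<close>

lemma dual_lattice_sum_Suc:
  assumes "r_weight \<mu> \<kappa> \<gamma> (Suc d) summable_on multi_indices (Suc d)"
  shows "dual_lattice_sum \<mu> \<kappa> \<gamma> N (Suc d) g = dual_lattice_sum \<mu> \<kappa> \<gamma> N d g
    + (\<Sum>\<^sub>\<infinity>k\<in>{k \<in> dual_lattice (Suc d) N g. k (Suc d) \<noteq> 0}. r_weight \<mu> \<kappa> \<gamma> (Suc d) k)"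
proof -
  let ?A = "{k \<in> dual_lattice (Suc d) N g - {zero_index (Suc d)}. k (Suc d) = 0}"
    and ?B = "{k \<in> dual_lattice (Suc d) N g. k (Suc d) \<noteq> 0}"
  have s: "r_weight \<mu> \<kappa> \<gamma> (Suc d) summable_on X" if "X \<subseteq> dual_lattice (Suc d) N g" for X
    using assms by (rule summable_on_subset_banach) (use that in \<open>auto simp: dual_lattice_def\<close>)
  have "dual_lattice (Suc d) N g - {zero_index (Suc d)} = ?A \<union> ?B" by auto
  then have "dual_lattice_sum \<mu> \<kappa> \<gamma> N (Suc d) g = infsum (r_weight \<mu> \<kappa> \<gamma> (Suc d)) (?A \<union> ?B)"
    unfolding dual_lattice_sum_def by (rule arg_cong)
  also have "\<dots> = infsum (r_weight \<mu> \<kappa> \<gamma> (Suc d)) ?A + infsum (r_weight \<mu> \<kappa> \<gamma> (Suc d)) ?B"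
    by (intro infsum_Un_disjoint s) auto
  also have "infsum (r_weight \<mu> \<kappa> \<gamma> (Suc d)) ?A
      = (\<Sum>\<^sub>\<infinity>k\<in>dual_lattice d N g - {zero_index d}. r_weight \<mu> \<kappa> \<gamma> (Suc d) (k(Suc d := 0)))"
    by (rule infsum_reindex_bij_betw[OF bij_betw_zero_extension, symmetric])
  also have "\<dots> = dual_lattice_sum \<mu> \<kappa> \<gamma> N d g"
    unfolding dual_lattice_sum_def by (intro infsum_cong) (auto simp: r_weight_def r1_weight_def intro!: prod.cong)
  finally show ?thesis .
qed

lemma dual_lattice_cong: "(\<And>j. j \<in> {1..d} \<Longrightarrow> g j = h j) \<Longrightarrow> dual_lattice d N g = dual_lattice d N h"
  by (simp add: dual_lattice_def)

lemma card_solutions_le: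
  assumes N: "prime N"
  shows "card {h \<in> {1..N - 1}. int N dvd b + m * int h} \<le> (if int N dvd m then N - 1 else 1)"
proof (cases "int N dvd m")
  case True
  have "card {h \<in> {1..N - 1}. int N dvd b + m * int h} \<le> card {1..N - 1}" by (intro card_mono) auto
  then show ?thesis using True by simp
next
  case False
  have "h = h'" if "h \<in> {1..N - 1}" "h' \<in> {1..N - 1}" "int N dvd b + m * int h" "int N dvd b + m * int h'" for h h'
  proof -
    have "int N dvd (b + m * int h) - (b + m * int h')" using that by (intro dvd_diff)
    then have "int N dvd m * (int h - int h')" by (simp add: algebra_simps)
    then have "int N dvd int h - int h'" using False N prime_dvd_mult_iff[of "int N"] by auto
    moreover have "\<bar>int h - int h'\<bar> < int N" using that by auto
    ultimately show ?thesis using zdvd_not_zless[of "\<bar>int h - int h'\<bar>" "int N"] by (cases "h = h'") auto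
  qed
  then have "card {h \<in> {1..N - 1}. int N dvd b + m * int h} \<le> Suc 0"
    by (subst card_le_Suc0_iff_eq) auto
  then show ?thesis using False by simp
qed

lemma infsum_multiples_le:
  assumes \<nu>: "\<nu> > 1" and \<kappa>: "\<kappa> > 1" and g: "\<gamma> > 0" and N: "N > 0"
  shows "(\<Sum>\<^sub>\<infinity>m\<in>{m. m \<noteq> 0 \<and> int N dvd m}. r1_weight \<nu> \<kappa> \<gamma> m) \<le> (\<Sum>\<^sub>\<infinity>m\<in>-{0}. r1_weight \<nu> \<kappa> \<gamma> m) / real N"
proof -
  note s = summable_on_subset_banach[OF r1_weight_summable[OF \<nu> g \<kappa>] subset_UNIV]
  have bij: "bij_betw (\<lambda>m. int N * m) (-{0}) {m. m \<noteq> 0 \<and> int N dvd m}"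
    using N by (intro bij_betwI[where g = "\<lambda>m. m div int N"]) auto
  have "(\<Sum>\<^sub>\<infinity>m\<in>{m. m \<noteq> 0 \<and> int N dvd m}. r1_weight \<nu> \<kappa> \<gamma> m) = (\<Sum>\<^sub>\<infinity>m\<in>-{0}. r1_weight \<nu> \<kappa> \<gamma> (int N * m))"
    by (rule infsum_reindex_bij_betw[OF bij, symmetric])
  also have "\<dots> \<le> (\<Sum>\<^sub>\<infinity>m\<in>-{0}. r1_weight \<nu> \<kappa> \<gamma> m * inverse (real N))"
  proof (rule infsum_mono)
    show "(\<lambda>m. r1_weight \<nu> \<kappa> \<gamma> (int N * m)) summable_on -{0}"
      unfolding summable_on_reindex_bij_betw[OF bij] by (rule s)
    show "(\<lambda>m. r1_weight \<nu> \<kappa> \<gamma> m * inverse (real N)) summable_on -{0}"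
      by (intro summable_on_cmult_left s)
    show "r1_weight \<nu> \<kappa> \<gamma> (int N * m) \<le> r1_weight \<nu> \<kappa> \<gamma> m * inverse (real N)" if "m \<in> -{0}" for m
      using r1_weight_multiple_le[OF \<kappa> g N, of m \<nu>] that \<nu> by (simp add: divide_inverse)
  qed
  also have "\<dots> = (\<Sum>\<^sub>\<infinity>m\<in>-{0}. r1_weight \<nu> \<kappa> \<gamma> m) / real N"
    by (simp add: infsum_cmult_left' divide_inverse)
  finally show ?thesis .
qed

text \<open>
  Exchanging the two sums, the weight of a frequency is counted once for every generator that puts it
  into the dual lattice: at most once if its last coordinate \<open>m\<close> is not divisible by \<open>N\<close>, and
  \<open>N - 1\<close> times at most otherwise. This multiplicity depends on \<open>m\<close> only, so the whole sum
  factorises over the coordinates; for the coordinates before the last one, the restriction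
  to the dual lattice is given up.
\<close>

lemma average_new_frequencies_le:
  assumes \<nu>: "\<nu> > 1" and \<kappa>: "\<kappa> > 1" and g: "\<And>j. j \<ge> 1 \<Longrightarrow> \<gamma> j > 0" and N: "prime N"
  shows "(\<Sum>h=1..N-1. \<Sum>\<^sub>\<infinity>k\<in>{k \<in> dual_lattice (Suc d) N (g(Suc d := h)). k (Suc d) \<noteq> 0}. r_weight \<nu> \<kappa> \<gamma> (Suc d) k)
    \<le> (1 + (real N - 1) / real N) * (\<Prod>j=1..d. \<Sum>\<^sub>\<infinity>m. r1_weight \<nu> \<kappa> (\<gamma> j) m)
        * (\<Sum>\<^sub>\<infinity>m\<in>-{0}. r1_weight \<nu> \<kappa> (\<gamma> (Suc d)) m)"
proof -
  have N1: "N > 1" using N by (rule prime_gt_1_nat)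
  define D where "D = (\<lambda>h. {k \<in> dual_lattice (Suc d) N (g(Suc d := h)). k (Suc d) \<noteq> 0})"
  define \<beta> where "\<beta> = (\<lambda>j. r1_weight \<nu> \<kappa> (\<gamma> j))"
  \<comment> \<open>\<open>c m\<close> bounds the number of generators that admit a frequency with last coordinate \<open>m\<close>; it is 0 at
      \<open>m = 0\<close> because such frequencies are not new.\<close>
  define c where "c = (\<lambda>m. if m = 0 then 0 else if int N dvd m then real N - 1 else (1::real))"
  define f where "f = (\<lambda>j m. if j = Suc d then \<beta> j m * c m else \<beta> j m)"
  have \<beta>0: "0 \<le> \<beta> j m" if "j \<ge> 1" for j m
    unfolding \<beta>_def using g[OF that] \<kappa> by (intro less_imp_le r1_weight_pos)
  have \<beta>s: "\<beta> j summable_on A" if "j \<ge> 1" for j A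
    unfolding \<beta>_def by (rule summable_on_subset_banach[OF r1_weight_summable[OF \<nu> g[OF that] \<kappa>] subset_UNIV])
  have c0: "0 \<le> c m" "c m \<le> real N" for m using N1 by (auto simp: c_def)
  have cs: "(\<lambda>m. \<beta> (Suc d) m * c m) summable_on UNIV"
  proof (rule summable_on_comparison_test)
    show "(\<lambda>m. \<beta> (Suc d) m * real N) summable_on UNIV" by (intro summable_on_cmult_left \<beta>s) simp
  qed (use c0 \<beta>0 in \<open>auto intro!: mult_left_mono\<close>)
  have f0: "0 \<le> f j m" if "j \<in> {1..Suc d}" for j m
    using that \<beta>0[of j m] c0[of m] by (auto simp: f_def)
  have fs: "f j summable_on UNIV" if "j \<in> {1..Suc d}" for j
    using that cs \<beta>s[of j] by (cases "j = Suc d") (auto simp: f_def)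
  have r: "r_weight \<nu> \<kappa> \<gamma> (Suc d) k = (\<Prod>j=1..Suc d. \<beta> j (k j))" for k
    by (simp add: r_weight_def \<beta>_def)
  have rs: "r_weight \<nu> \<kappa> \<gamma> (Suc d) summable_on A" if "A \<subseteq> multi_indices (Suc d)" for A
    using r_weight_summable[OF \<nu> \<kappa> g] that by (rule summable_on_subset_banach)
  have DI: "D h \<subseteq> multi_indices (Suc d)" for h by (auto simp: D_def dual_lattice_def)
  let ?t = "\<lambda>h k. if k \<in> D h then r_weight \<nu> \<kappa> \<gamma> (Suc d) k else 0"
  have ts: "?t h summable_on multi_indices (Suc d)" for h
  proof -
    have "?t h summable_on multi_indices (Suc d) \<longleftrightarrow> r_weight \<nu> \<kappa> \<gamma> (Suc d) summable_on D h"
      using DI[of h] by (intro summable_on_cong_neutral) auto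
    then show ?thesis using rs[OF DI] by simp
  qed
  have "(\<Sum>h=1..N-1. infsum (r_weight \<nu> \<kappa> \<gamma> (Suc d)) (D h)) = (\<Sum>h=1..N-1. \<Sum>\<^sub>\<infinity>k\<in>multi_indices (Suc d). ?t h k)"
    using DI by (intro sum.cong refl infsum_cong_neutral) auto
  also have "\<dots> = (\<Sum>\<^sub>\<infinity>k\<in>multi_indices (Suc d). \<Sum>h=1..N-1. ?t h k)"
    by (rule infsum_finite_sum[symmetric]) (simp_all add: ts)
  also have "\<dots> \<le> (\<Sum>\<^sub>\<infinity>k\<in>multi_indices (Suc d). \<Prod>j=1..Suc d. f j (k j))"
  proof (rule infsum_mono)
    show "(\<lambda>k. \<Sum>h=1..N-1. ?t h k) summable_on multi_indices (Suc d)" by (intro summable_on_finite_sum ts) simp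
    show "(\<lambda>k. \<Prod>j=1..Suc d. f j (k j)) summable_on multi_indices (Suc d)"
      by (intro prod_summable_on_multi_indices f0 fs)
    fix k assume k: "k \<in> multi_indices (Suc d)"
    let ?b = "\<Sum>j=1..d. k j * int (g j)"
    have mem: "k \<in> D h \<longleftrightarrow> k (Suc d) \<noteq> 0 \<and> int N dvd ?b + k (Suc d) * int h" for h
      using k by (auto simp: D_def dual_lattice_def)
    have "(\<Sum>h=1..N-1. ?t h k) = real (card {h \<in> {1..N-1}. k \<in> D h}) * r_weight \<nu> \<kappa> \<gamma> (Suc d) k"
      by (simp add: sum.If_cases Int_def)
    also have "\<dots> \<le> c (k (Suc d)) * r_weight \<nu> \<kappa> \<gamma> (Suc d) k"
    proof (rule mult_right_mono)
      show "real (card {h \<in> {1..N-1}. k \<in> D h}) \<le> c (k (Suc d))"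
      proof (cases "k (Suc d) = 0")
        case True
        then show ?thesis by (simp add: mem c_def)
      next
        case False
        then have "{h \<in> {1..N-1}. k \<in> D h} = {h \<in> {1..N-1}. int N dvd ?b + k (Suc d) * int h}"
          by (simp add: mem)
        then have "card {h \<in> {1..N-1}. k \<in> D h} \<le> (if int N dvd k (Suc d) then N - 1 else 1)"
          using card_solutions_le[OF N, of ?b "k (Suc d)"] by simp
        then show ?thesis using False N1 by (auto simp: c_def of_nat_diff split: if_splits)
      qed
      show "0 \<le> r_weight \<nu> \<kappa> \<gamma> (Suc d) k" by (rule less_imp_le[OF r_weight_pos[OF \<kappa> g]])
    qed
    also have "\<dots> = (\<Prod>j=1..Suc d. f j (k j))"
      unfolding r by (simp add: f_def mult_ac)
    finally show "(\<Sum>h=1..N-1. ?t h k) \<le> (\<Prod>j=1..Suc d. f j (k j))" .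
  qed
  also have "\<dots> = (\<Prod>j=1..Suc d. \<Sum>\<^sub>\<infinity>m. f j m)" by (rule infsum_prod_multi_indices[OF f0 fs])
  also have "\<dots> = (\<Prod>j=1..d. \<Sum>\<^sub>\<infinity>m. \<beta> j m) * (\<Sum>\<^sub>\<infinity>m. \<beta> (Suc d) m * c m)"
    by (simp add: f_def)
  also have "\<dots> \<le> (\<Prod>j=1..d. \<Sum>\<^sub>\<infinity>m. \<beta> j m) * ((1 + (real N - 1) / real N) * (\<Sum>\<^sub>\<infinity>m\<in>-{0}. \<beta> (Suc d) m))"
  proof (rule mult_left_mono)
    show "0 \<le> (\<Prod>j=1..d. \<Sum>\<^sub>\<infinity>m. \<beta> j m)" using \<beta>0 by (intro prod_nonneg ballI infsum_nonneg) auto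
    let ?M = "{m. m \<noteq> 0 \<and> int N dvd m}"
    let ?e = "\<lambda>m. if m \<in> ?M then \<beta> (Suc d) m else 0"
    have es: "?e summable_on -{0}"
    proof -
      have "?e summable_on -{0} \<longleftrightarrow> \<beta> (Suc d) summable_on ?M" by (intro summable_on_cong_neutral) auto
      then show ?thesis using \<beta>s by simp
    qed
    have "(\<Sum>\<^sub>\<infinity>m. \<beta> (Suc d) m * c m) \<le> (\<Sum>\<^sub>\<infinity>m\<in>-{0}. \<beta> (Suc d) m + (real N - 1) * ?e m)"
    proof (rule infsum_mono_neutral[OF cs])
      show "(\<lambda>m. \<beta> (Suc d) m + (real N - 1) * ?e m) summable_on -{0}"
        by (intro summable_on_add summable_on_cmult_right es \<beta>s) simp
    qed (use \<beta>0 N1 in \<open>auto simp: c_def mult_ac\<close>)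
    also have "\<dots> = (\<Sum>\<^sub>\<infinity>m\<in>-{0}. \<beta> (Suc d) m) + (real N - 1) * (\<Sum>\<^sub>\<infinity>m\<in>-{0}. ?e m)"
      by (simp only: infsum_add[OF \<beta>s[of "Suc d"] summable_on_cmult_right[OF es]] infsum_cmult_right')
    also have "(\<Sum>\<^sub>\<infinity>m\<in>-{0}. ?e m) = (\<Sum>\<^sub>\<infinity>m\<in>?M. \<beta> (Suc d) m)" by (intro infsum_cong_neutral) auto
    finally have "(\<Sum>\<^sub>\<infinity>m. \<beta> (Suc d) m * c m)
        \<le> (\<Sum>\<^sub>\<infinity>m\<in>-{0}. \<beta> (Suc d) m) + (real N - 1) * (\<Sum>\<^sub>\<infinity>m\<in>?M. \<beta> (Suc d) m)" .
    also have "\<dots> \<le> (\<Sum>\<^sub>\<infinity>m\<in>-{0}. \<beta> (Suc d) m) + (real N - 1) * ((\<Sum>\<^sub>\<infinity>m\<in>-{0}. \<beta> (Suc d) m) / real N)"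
      unfolding \<beta>_def using N1 by (intro add_left_mono mult_left_mono infsum_multiples_le \<nu> \<kappa> g) auto
    finally show "(\<Sum>\<^sub>\<infinity>m. \<beta> (Suc d) m * c m) \<le> (1 + (real N - 1) / real N) * (\<Sum>\<^sub>\<infinity>m\<in>-{0}. \<beta> (Suc d) m)"
      by (simp add: distrib_right)
  qed
  finally show ?thesis by (simp add: D_def \<beta>_def mult_ac)
qed

section \<open>The component-by-component construction\<close>

text \<open>
  A minimal increment of the error has minimal gauge, hence a gauge below the average over all
  generators. Bounding the gauge of each increment termwise before averaging is what replaces
  the weights by the summable dominating ones.
\<close>

lemma cbc_step:
  assumes \<mu>: "\<mu> > 1" and a: "0 \<le> a" "a < \<mu> - 1" and g: "\<And>j. j \<ge> 1 \<Longrightarrow> 0 < \<gamma> j"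
    and \<kappa>: "\<kappa> \<ge> exp (exp 2)" "\<And>j. j \<ge> 1 \<Longrightarrow> \<kappa> \<ge> exp (exp 2 * \<gamma> j powr (1 / \<mu>))"
    and N: "prime N"
    and min: "\<And>h. h \<in> {1..N - 1} \<Longrightarrow>
      dual_lattice_sum \<mu> \<kappa> \<gamma> N (Suc d) v \<le> dual_lattice_sum \<mu> \<kappa> \<gamma> N (Suc d) (v(Suc d := h))"
  shows "log_gauge (2 * \<mu>) a (dual_lattice_sum \<mu> \<kappa> \<gamma> N (Suc d) v)
    \<le> log_gauge (2 * \<mu>) a (dual_lattice_sum \<mu> \<kappa> \<gamma> N d v)
      + 3 / real N * (\<Prod>j=1..d. \<Sum>\<^sub>\<infinity>m. r1_weight (\<mu> - a) \<kappa> (dominating_weights \<mu> a \<gamma> j) m)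
          * (\<Sum>\<^sub>\<infinity>m\<in>-{0}. r1_weight (\<mu> - a) \<kappa> (dominating_weights \<mu> a \<gamma> (Suc d)) m)"
proof -
  have N1: "N > 1" using N by (rule prime_gt_1_nat)
  have k0: "1 < \<kappa>" using \<kappa>(1) less_le_trans[of 1 "exp (exp 2)" \<kappa>] by simp
  have dw: "0 < dominating_weights \<mu> a \<gamma> j" if "j \<ge> 1" for j
    using g[OF that] \<mu> by (auto simp: dominating_weights_def)
  have \<nu>: "\<mu> - a > 1" using a by simp
  let ?\<gamma> = "dominating_weights \<mu> a \<gamma>" and ?G = "log_gauge (2 * \<mu>) a"
  define D where "D = (\<lambda>h. {k \<in> dual_lattice (Suc d) N (v(Suc d := h)). k (Suc d) \<noteq> 0})"
  define \<theta> where "\<theta> = (\<lambda>h. infsum (r_weight \<mu> \<kappa> \<gamma> (Suc d)) (D h))"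
  have DI: "D h \<subseteq> multi_indices (Suc d)" for h by (auto simp: D_def dual_lattice_def)
  have split: "dual_lattice_sum \<mu> \<kappa> \<gamma> N (Suc d) (v(Suc d := h)) = dual_lattice_sum \<mu> \<kappa> \<gamma> N d v + \<theta> h" for h
  proof -
    have "dual_lattice d N (v(Suc d := h)) = dual_lattice d N v" by (rule dual_lattice_cong) auto
    then show ?thesis
      using dual_lattice_sum_Suc[OF r_weight_summable[OF \<mu> k0 g], where d = d and N = N and g = "v(Suc d := h)"]
      by (simp add: \<theta>_def D_def dual_lattice_sum_def)
  qed
  have nonneg: "0 \<le> r_weight \<mu> \<kappa> \<gamma> n k" for n k by (rule less_imp_le[OF r_weight_pos[OF k0 g]])
  have e0: "0 \<le> dual_lattice_sum \<mu> \<kappa> \<gamma> N d v" unfolding dual_lattice_sum_def by (intro infsum_nonneg nonneg)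
  have \<theta>0: "0 \<le> \<theta> h" for h unfolding \<theta>_def by (intro infsum_nonneg nonneg)
  define x where "x = \<theta> (v (Suc d))"
  define B where "B = (\<Prod>j=1..d. \<Sum>\<^sub>\<infinity>m. r1_weight (\<mu> - a) \<kappa> (?\<gamma> j) m)
      * (\<Sum>\<^sub>\<infinity>m\<in>-{0}. r1_weight (\<mu> - a) \<kappa> (?\<gamma> (Suc d)) m)"
  have B0: "0 \<le> B" unfolding B_def
    by (intro mult_nonneg_nonneg prod_nonneg ballI infsum_nonneg less_imp_le[OF r1_weight_pos] dw k0) auto
  have x_le: "?G x \<le> (\<Sum>\<^sub>\<infinity>k\<in>D h. r_weight (\<mu> - a) \<kappa> ?\<gamma> (Suc d) k)" if h: "h \<in> {1..N - 1}" for h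
  proof -
    have "x \<le> \<theta> h" using min[OF h] split[of h] split[of "v (Suc d)"] by (simp add: x_def)
    then have "?G x \<le> ?G (\<theta> h)" using \<mu> a \<theta>0 by (intro log_gauge_mono) (auto simp: x_def)
    also have "\<dots> \<le> (\<Sum>\<^sub>\<infinity>k\<in>D h. r_weight (\<mu> - a) \<kappa> ?\<gamma> (Suc d) k)"
      unfolding \<theta>_def
    proof (rule log_gauge_infsum_le[OF a(1)])
      show "?G (r_weight \<mu> \<kappa> \<gamma> (Suc d) k) \<le> r_weight (\<mu> - a) \<kappa> ?\<gamma> (Suc d) k" if "k \<in> D h" for k
        using that by (intro log_gauge_r_weight_le[where i = "Suc d"] \<mu> a g \<kappa>) (auto simp: D_def)
      show "r_weight \<mu> \<kappa> \<gamma> (Suc d) summable_on D h"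
        by (rule summable_on_subset_banach[OF r_weight_summable[OF \<mu> k0 g] DI])
      show "r_weight (\<mu> - a) \<kappa> ?\<gamma> (Suc d) summable_on D h"
        by (rule summable_on_subset_banach[OF r_weight_summable[OF \<nu> k0 dw] DI])
      show "0 < r_weight \<mu> \<kappa> \<gamma> (Suc d) k" for k by (intro r_weight_pos k0 g)
    qed (use \<mu> in simp)
    finally show ?thesis .
  qed
  have "real (N - 1) * ?G x = (\<Sum>h=1..N-1. ?G x)" by simp
  also have "\<dots> \<le> (\<Sum>h=1..N-1. \<Sum>\<^sub>\<infinity>k\<in>D h. r_weight (\<mu> - a) \<kappa> ?\<gamma> (Suc d) k)" by (intro sum_mono x_le)
  also have "\<dots> \<le> (1 + (real N - 1) / real N) * B"
    unfolding D_def B_def using average_new_frequencies_le[OF \<nu> k0 dw N] by (simp add: mult.assoc)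
  also have "\<dots> \<le> real (N - 1) * (3 / real N) * B"
  proof (rule mult_right_mono[OF _ B0])
    \<comment> \<open>After division by \<open>N - 1\<close> this reads \<open>1 / (N - 1) + 1 / N \<le> 3 / N\<close>.\<close>
    have "2 \<le> real N" using N1 by simp
    then show "1 + (real N - 1) / real N \<le> real (N - 1) * (3 / real N)"
      using N1 by (simp add: of_nat_diff field_simps)
  qed
  finally have "real (N - 1) * ?G x \<le> real (N - 1) * (3 / real N * B)" by (simp only: mult.assoc)
  then have "?G x \<le> 3 / real N * B" by (rule mult_left_le_imp_le) (use N1 in simp)
  moreover have "dual_lattice_sum \<mu> \<kappa> \<gamma> N (Suc d) v = dual_lattice_sum \<mu> \<kappa> \<gamma> N d v + x"
    using split[of "v (Suc d)"] by (simp add: x_def)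
  moreover have "?G (dual_lattice_sum \<mu> \<kappa> \<gamma> N d v + x) \<le> ?G (dual_lattice_sum \<mu> \<kappa> \<gamma> N d v) + ?G x"
    using \<mu> a e0 \<theta>0 by (intro log_gauge_add_le) (auto simp: x_def)
  ultimately show ?thesis by (simp add: B_def mult.assoc)
qed

text \<open>
  In dimension one all generators are equally good, which makes the fixed choice \<open>g 1 = 1\<close> of the
  algorithm a minimising one.
\<close>

lemma dual_lattice_one:
  assumes N: "prime N" and "g 1 \<in> {1..N - 1}" "h 1 \<in> {1..N - 1}"
  shows "dual_lattice 1 N g = dual_lattice 1 N h"
proof -
  have "int N dvd m * int c \<longleftrightarrow> int N dvd m" if "c \<in> {1..N - 1}" for m c
  proof -
    have "\<not> N dvd c" using that by (auto dest: dvd_imp_le)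
    then show ?thesis using N by (simp add: prime_dvd_mult_iff)
  qed
  then show ?thesis using assms by (simp add: dual_lattice_def)
qed

text \<open>
  With \<open>B j\<close> for the sums in the product, the induction starts in dimension 0, where the error is 0. The
  step adds \<open>3 / N * B (d + 1)\<close> times the product over \<open>1, ..., d\<close>, which is exactly the
  growth of the right-hand side.
\<close>

theorem log_gauge_dual_lattice_sum_le:
  assumes \<mu>: "\<mu> > 1" and a: "0 \<le> a" "a < \<mu> - 1" and g: "\<And>j. j \<ge> 1 \<Longrightarrow> 0 < \<gamma> j"
    and \<kappa>: "\<kappa> \<ge> exp (exp 2)" "\<And>j. j \<ge> 1 \<Longrightarrow> \<kappa> \<ge> exp (exp 2 * \<gamma> j powr (1 / \<mu>))"
    and N: "prime N" and v: "cbc_vector \<mu> \<kappa> \<gamma> N s v" and d: "d \<le> s"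
  shows "log_gauge (2 * \<mu>) a (dual_lattice_sum \<mu> \<kappa> \<gamma> N d v)
    \<le> 3 / real N * (\<Prod>j=1..d. 1 + (\<Sum>\<^sub>\<infinity>m\<in>-{0}. r1_weight (\<mu> - a) \<kappa> (dominating_weights \<mu> a \<gamma> j) m))"
  using d
proof (induction d)
  case 0
  have empty: "dual_lattice 0 N v - {zero_index 0} = {}" by (auto simp: dual_lattice_def multi_indices_def)
  show ?case unfolding dual_lattice_sum_def empty by (simp add: log_gauge_def)
next
  case (Suc d)
  have N1: "N > 1" using N by (rule prime_gt_1_nat)
  have k0: "1 < \<kappa>" using \<kappa>(1) less_le_trans[of 1 "exp (exp 2)" \<kappa>] by simp
  have dw: "0 < dominating_weights \<mu> a \<gamma> j" if "j \<ge> 1" for j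
    using g[OF that] \<mu> by (auto simp: dominating_weights_def)
  define B where "B = (\<lambda>j. \<Sum>\<^sub>\<infinity>m\<in>-{0}. r1_weight (\<mu> - a) \<kappa> (dominating_weights \<mu> a \<gamma> j) m)"
  have tot: "(\<Sum>\<^sub>\<infinity>m. r1_weight (\<mu> - a) \<kappa> (dominating_weights \<mu> a \<gamma> j) m) = 1 + B j" if "j \<ge> 1" for j
  proof -
    let ?r = "r1_weight (\<mu> - a) \<kappa> (dominating_weights \<mu> a \<gamma> j)"
    have s: "?r summable_on A" for A
      by (rule summable_on_subset_banach[OF r1_weight_summable[OF _ dw[OF that] k0] subset_UNIV]) (use a in simp)
    have "infsum ?r ({0} \<union> -{0}) = infsum ?r {0} + infsum ?r (-{0})"
      by (intro infsum_Un_disjoint s) auto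
    moreover have "?r 0 = 1" by (simp add: r1_weight_def)
    ultimately show ?thesis by (simp add: B_def)
  qed
  have min: "dual_lattice_sum \<mu> \<kappa> \<gamma> N (Suc d) v \<le> dual_lattice_sum \<mu> \<kappa> \<gamma> N (Suc d) (v(Suc d := h))"
    if h: "h \<in> {1..N - 1}" for h
  proof (cases "d = 0")
    case True
    have "dual_lattice 1 N v = dual_lattice 1 N (v(1 := h))"
      using v h N1 by (intro dual_lattice_one N) (auto simp: cbc_vector_def)
    then show ?thesis using True by (simp add: dual_lattice_sum_def)
  next
    case False
    then have "(lattice_error \<mu> \<kappa> \<gamma> N (Suc d) v)\<^sup>2 \<le> (lattice_error \<mu> \<kappa> \<gamma> N (Suc d) (v(Suc d := h)))\<^sup>2"
      using v h Suc.prems unfolding cbc_vector_def by auto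
    then show ?thesis using N1 by (simp add: lattice_error_squared[OF \<mu> k0 _ g])
  qed
  have "log_gauge (2 * \<mu>) a (dual_lattice_sum \<mu> \<kappa> \<gamma> N (Suc d) v)
      \<le> log_gauge (2 * \<mu>) a (dual_lattice_sum \<mu> \<kappa> \<gamma> N d v)
        + 3 / real N * (\<Prod>j=1..d. \<Sum>\<^sub>\<infinity>m. r1_weight (\<mu> - a) \<kappa> (dominating_weights \<mu> a \<gamma> j) m) * B (Suc d)"
    unfolding B_def by (rule cbc_step[OF \<mu> a g \<kappa> N min])
  also have "\<dots> \<le> 3 / real N * (\<Prod>j=1..d. 1 + B j) + 3 / real N * (\<Prod>j=1..d. 1 + B j) * B (Suc d)"
    using Suc by (simp add: tot B_def)
  also have "\<dots> = 3 / real N * (\<Prod>j=1..Suc d. 1 + B j)" by (simp add: algebra_simps)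
  finally show ?case by (simp add: B_def)
qed

theorem theorem1:
  fixes \<mu> lam \<kappa> :: real
  assumes "\<mu> > 1" and "1 / \<mu> < lam" and "lam \<le> 1" and "\<kappa> \<ge> exp (exp 2)"
  shows "\<exists>C>0. \<forall>(\<gamma> :: nat \<Rightarrow> real) (s :: nat) (N :: nat) (g :: nat \<Rightarrow> nat).
           (\<forall>j\<ge>1. \<gamma> j > 0) \<longrightarrow>
           (\<forall>j\<ge>1. \<kappa> \<ge> max (exp (exp 2)) (exp (exp 2 * \<gamma> j powr (1 / \<mu>)))) \<longrightarrow>
           s \<ge> 1 \<longrightarrow> prime N \<longrightarrow>
           cbc_vector \<mu> \<kappa> \<gamma> N s g \<longrightarrow>
           (\<forall>d\<in>{1..s}.
              real N \<ge> exp (2 * \<mu>) * (2 * \<mu>) powr (\<mu> * (lam - 1)) * T_bound C \<mu> lam \<gamma> d \<longrightarrow>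
              real N > T_bound C \<mu> lam \<gamma> d \<longrightarrow>
              (lattice_error \<mu> \<kappa> \<gamma> N d g)\<^sup>2
                \<le> T_bound C \<mu> lam \<gamma> d
                    / (real N * ln (real N / T_bound C \<mu> lam \<gamma> d) powr (\<mu> * (1 - lam))))"
proof -
  define a where "a = \<mu> * (1 - lam)"
  have a: "0 \<le> a" "a < \<mu> - 1" using assms by (auto simp: a_def field_simps)
  have k0: "1 < \<kappa>" using assms(4) less_le_trans[of 1 "exp (exp 2)" \<kappa>] by simp
  define S where "S = (\<Sum>\<^sub>\<infinity>m\<in>-{0}. r1_weight (\<mu> - a) \<kappa> 1 m)"
  have S: "0 < S"
  proof -
    have "r1_weight (\<mu> - a) \<kappa> 1 summable_on -{0}"
      by (rule summable_on_subset_banach[OF r1_weight_summable subset_UNIV]) (use a k0 in auto)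
    then have "(\<Sum>m\<in>{1}. r1_weight (\<mu> - a) \<kappa> 1 m) \<le> S"
      unfolding S_def using k0 by (intro finite_sum_le_infsum) (auto intro!: less_imp_le[OF r1_weight_pos])
    then show ?thesis using r1_weight_pos[of 1 \<kappa> "\<mu> - a" 1] k0 by simp
  qed
  \<comment> \<open>Chosen so that the sum of the dominating weights over the non-zero frequencies of coordinate \<open>j\<close>
      is the summand \<open>2 * C * \<gamma> j * \<dots>\<close> in \<open>T_bound\<close>; the 2 there is meant for the two signs of a
      frequency.\<close>
  define C where "C = (2 + \<mu>) powr a * S / 2"
  show ?thesis
  proof (intro exI[of _ C] conjI allI impI ballI)
    show "0 < C" using S assms by (simp add: C_def)
    fix \<gamma> :: "nat \<Rightarrow> real" and s N d :: nat and g :: "nat \<Rightarrow> nat"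
    assume \<gamma>: "\<forall>j\<ge>1. \<gamma> j > 0" and \<kappa>: "\<forall>j\<ge>1. \<kappa> \<ge> max (exp (exp 2)) (exp (exp 2 * \<gamma> j powr (1 / \<mu>)))"
      and N: "prime N" and g: "cbc_vector \<mu> \<kappa> \<gamma> N s g" and d: "d \<in> {1..s}"
      and NT: "real N > T_bound C \<mu> lam \<gamma> d"
    define T where "T = T_bound C \<mu> lam \<gamma> d"
    have B: "(\<Sum>\<^sub>\<infinity>m\<in>-{0}. r1_weight (\<mu> - a) \<kappa> (dominating_weights \<mu> a \<gamma> j) m)
        = 2 * C * \<gamma> j * max 1 (ln (inverse (\<gamma> j))) powr a" for j
    proof -
      have "(\<Sum>\<^sub>\<infinity>m\<in>-{0}. r1_weight (\<mu> - a) \<kappa> (dominating_weights \<mu> a \<gamma> j) m)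
          = (\<Sum>\<^sub>\<infinity>m\<in>-{0}. dominating_weights \<mu> a \<gamma> j * r1_weight (\<mu> - a) \<kappa> 1 m)"
        by (intro infsum_cong) (simp add: r1_weight_def)
      also have "\<dots> = dominating_weights \<mu> a \<gamma> j * S" unfolding S_def by (rule infsum_cmult_right')
      finally show ?thesis by (simp add: dominating_weights_def C_def)
    qed
    have T: "T = 3 * (\<Prod>j=1..d. 1 + (\<Sum>\<^sub>\<infinity>m\<in>-{0}. r1_weight (\<mu> - a) \<kappa> (dominating_weights \<mu> a \<gamma> j) m))"
      by (simp only: B T_def T_bound_def a_def[symmetric])
    have T0: "0 < T"
      unfolding T B using \<open>0 < C\<close> \<gamma> by (intro mult_pos_pos prod_pos) (auto intro!: add_pos_nonneg)
    have N0: "0 < real N" using T0 NT by (simp add: T_def)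
    have err: "(lattice_error \<mu> \<kappa> \<gamma> N d g)\<^sup>2 = dual_lattice_sum \<mu> \<kappa> \<gamma> N d g"
      using \<gamma> d N0 by (intro lattice_error_squared assms k0) auto
    have "log_gauge (2 * \<mu>) a (dual_lattice_sum \<mu> \<kappa> \<gamma> N d g) \<le> T / real N"
      using log_gauge_dual_lattice_sum_le[OF assms(1) a _ assms(4) _ N g, of d] \<gamma> \<kappa> d by (simp add: T)
    then have "(lattice_error \<mu> \<kappa> \<gamma> N d g)\<^sup>2 \<le> (T / real N) / ln (1 / (T / real N)) powr a"
      using T0 N0 NT a assms(1) unfolding err[symmetric] by (intro le_of_log_gauge_le[where p = "2 * \<mu>"]) (auto simp: T_def)
    also have "\<dots> = T / (real N * ln (real N / T) powr a)" by simp
    finally show "(lattice_error \<mu> \<kappa> \<gamma> N d g)\<^sup>2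
        \<le> T_bound C \<mu> lam \<gamma> d / (real N * ln (real N / T_bound C \<mu> lam \<gamma> d) powr (\<mu> * (1 - lam)))"
      by (simp add: T_def a_def)
  qed
qed

end
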